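(* Let $(R,\mathbf{m})$ be a one-dimensional Cohen-Macaulay local ring (with infinite residue field) and let $I\subset R$ be an $\mathbf{m}$-primary ideal. Let $r(I)$ be the reduction number of $I$, $pn(I)$ the postulation number of $I$, and $st(R)$ the stability of $R$. Then: (i) (Sally-Vasconcelos) $r(I)=pn(I)\le st(R)\le e_0(R)-1$. (ii) $pn(I)\le\beta(I)$, where $$\beta(I)=\begin{cases}0 & \text{if } e_0(I)=\lambda(I),\\ 1 & \text{if } e_0(I)=b(I) \text{ (and } e_0(I)\ne\lambda(I)),\\ e_1(I)-2e_0(I)+\lambda(I)+b(I)+2 & \text{if } e_0(I)>b(I).\end{cases}$$
   Context: For an $\mathbf{m}$-primary ideal $I$ of a one-dimensional Cohen-Macaulay local ring $(R,\mathbf{m})$, put $H^0_I(n)=\mathrm{Length}_R(I^n/I^{n+1})$ and $H^1_I(n)=\sum_{j=0}^n H^0_I(j)=\mathrm{Length}_R(R/I^{n+1})$ for $n\ge 0$. The normalized Hilbert coefficients $e_0(I),e_1(I)$ are the integers with $H^0_I(n)=e_0(I)$ and $H^1_I(n)=e_0(I)(n+1)-e_1(I)$ for $n\gg 0$; one writes $e_0(R)=e_0(\mathbf{m})$. It is known that $H^0_I(n)\le e_0(I)$ for all $n\ge 0$. The postulation number $pn(I)$ is the least integer $pn(I)\ge 0$ such that $H^0_I(n)=e_0(I)$ for all $n\ge pn(I)$. The stability $st(R)$ is the supremum of $pn(I)$ as $I$ ranges over all $\mathbf{m}$-primary ideals of $R$. An ideal $J\subseteq I$ is a reduction of $I$ if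 $I^{r+1}=JI^r$ for some integer $r\ge 0$; the reduction number $r(I)$ is the least integer $r\ge 0$ for which there is a minimal reduction $J$ of $I$ (minimal with respect to inclusion) with $I^{r+1}=JI^{r}$. One sets $\lambda(I)=\mathrm{Length}_R(R/I)$ and $b(I)=\mathrm{Length}_R(I/I^2)$. *)

theory Defs
  imports
    "HOL-Algebra.Ring_Divisibility"
    "HOL-Algebra.Ideal_Product"
    "HOL-Algebra.QuotRing"
    "HOL-Algebra.Module"
    "HOL-Library.Extended_Real"
begin

section \<open>Length of modules\<close>

text \<open>The module record extends the ring record; the fields \<open>mult\<close> and \<open>one\<close> play no role for a
  module, and are copied from the ring or left undefined below.\<close>

definition ideal_module :: "('a, 'b) ring_scheme \<Rightarrow> 'a set \<Rightarrow> ('a, 'a) module" where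
  "ideal_module R I =
    \<lparr>carrier = I, mult = mult R, one = \<one>\<^bsub>R\<^esub>, zero = \<zero>\<^bsub>R\<^esub>, add = add R, smult = mult R\<rparr>"

definition quot_module :: "('a, 'c, 'd) module_scheme \<Rightarrow> 'c set \<Rightarrow> ('a, 'c set) module" where
  "quot_module M N =
    \<lparr>carrier = a_rcosets\<^bsub>M\<^esub> N, mult = undefined, one = undefined, zero = N, add = set_add M,
     smult = (\<lambda>a X. \<Union>x\<in>X. N +>\<^bsub>M\<^esub> (a \<odot>\<^bsub>M\<^esub> x))\<rparr>"

definition module_length :: "('a, 'b) ring_scheme \<Rightarrow> ('a, 'c, 'd) module_scheme \<Rightarrow> enat" where
  "module_length R M =
    Sup {enat n |n N. (\<forall>i\<le>n. submodule (N i) R M) \<and> (\<forall>i<n. N i \<subset> N (Suc i))}"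

text \<open>The length of the \<open>R\<close>-module \<open>I/J\<close> for ideals \<open>J \<subseteq> I\<close>, as a natural number. It is
  only used for quotients of finite length (\<open>the_enat\<close> is unspecified at infinity).\<close>

definition quot_length :: "('a, 'b) ring_scheme \<Rightarrow> 'a set \<Rightarrow> 'a set \<Rightarrow> nat" where
  "quot_length R I J = the_enat (module_length R (quot_module (ideal_module R I) J))"


section \<open>Cohen-Macaulay local rings\<close>

definition krull_dim :: "('a, 'b) ring_scheme \<Rightarrow> enat" where
  "krull_dim R =
    Sup {enat n |n P. (\<forall>i\<le>n. primeideal (P i) R) \<and> (\<forall>i<n. P i \<subset> P (Suc i))}"

text \<open>Each \<open>xs ! i\<close> is a nonzerodivisor on \<open>R/(xs ! 0, \<dots>, xs ! (i - 1))\<close>, and \<open>R/(xs) \<noteq> 0\<close>.\<close>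

definition regular_sequence :: "('a, 'b) ring_scheme \<Rightarrow> 'a list \<Rightarrow> bool" where
  "regular_sequence R xs \<longleftrightarrow>
    set xs \<subseteq> carrier R \<and>
    (\<forall>i<length xs. \<forall>a\<in>carrier R.
      xs ! i \<otimes>\<^bsub>R\<^esub> a \<in> Idl\<^bsub>R\<^esub> (set (take i xs)) \<longrightarrow> a \<in> Idl\<^bsub>R\<^esub> (set (take i xs))) \<and>
    Idl\<^bsub>R\<^esub> (set xs) \<noteq> carrier R"

definition local_depth :: "('a, 'b) ring_scheme \<Rightarrow> 'a set \<Rightarrow> enat" where
  "local_depth R m = Sup {enat (length xs) |xs. regular_sequence R xs \<and> set xs \<subseteq> m}"

locale noetherian_local_ring = noetherian_ring R + cring R for R (structure) +
  fixes m :: "'a set"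
  assumes maximal: "maximalideal m R"
    and unique_maximal: "maximalideal n R \<Longrightarrow> n = m"

locale cohen_macaulay_local_ring = noetherian_local_ring +
  assumes depth_eq_dim: "local_depth R m = krull_dim R"


section \<open>Primary ideals, powers and reductions\<close>

definition ideal_radical :: "('a, 'b) ring_scheme \<Rightarrow> 'a set \<Rightarrow> 'a set" where
  "ideal_radical R I = {a \<in> carrier R. \<exists>n::nat. a [^]\<^bsub>R\<^esub> n \<in> I}"

definition primary_ideal :: "('a, 'b) ring_scheme \<Rightarrow> 'a set \<Rightarrow> bool" where
  "primary_ideal R I \<longleftrightarrow>
    ideal I R \<and> I \<noteq> carrier R \<and>
    (\<forall>a\<in>carrier R. \<forall>b\<in>carrier R. a \<otimes>\<^bsub>R\<^esub> b \<in> I \<longrightarrow> a \<in> I \<or> b \<in> ideal_radical R I)"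

definition primary_to :: "('a, 'b) ring_scheme \<Rightarrow> 'a set \<Rightarrow> 'a set \<Rightarrow> bool" where
  "primary_to R m I \<longleftrightarrow> primary_ideal R I \<and> ideal_radical R I = m"

definition ideal_power :: "('a, 'b) ring_scheme \<Rightarrow> 'a set \<Rightarrow> nat \<Rightarrow> 'a set" where
  "ideal_power R I n = I [^]\<^bsub>ideals_set R\<^esub> n"

definition is_reduction :: "('a, 'b) ring_scheme \<Rightarrow> 'a set \<Rightarrow> 'a set \<Rightarrow> bool" where
  "is_reduction R I J \<longleftrightarrow>
    ideal J R \<and> J \<subseteq> I \<and> (\<exists>r. ideal_power R I (r + 1) = J \<cdot>\<^bsub>R\<^esub> ideal_power R I r)"

definition minimal_reduction :: "('a, 'b) ring_scheme \<Rightarrow> 'a set \<Rightarrow> 'a set \<Rightarrow> bool" where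
  "minimal_reduction R I J \<longleftrightarrow>
    is_reduction R I J \<and> (\<forall>K. is_reduction R I K \<and> K \<subseteq> J \<longrightarrow> K = J)"

definition reduction_number :: "('a, 'b) ring_scheme \<Rightarrow> 'a set \<Rightarrow> nat" where
  "reduction_number R I =
    (LEAST r. \<exists>J. minimal_reduction R I J \<and>
      ideal_power R I (r + 1) = J \<cdot>\<^bsub>R\<^esub> ideal_power R I r)"


section \<open>Hilbert functions and coefficients\<close>

definition hilb0 :: "('a, 'b) ring_scheme \<Rightarrow> 'a set \<Rightarrow> nat \<Rightarrow> nat" where
  "hilb0 R I n = quot_length R (ideal_power R I n) (ideal_power R I (n + 1))"

definition hilb1 :: "('a, 'b) ring_scheme \<Rightarrow> 'a set \<Rightarrow> nat \<Rightarrow> nat" where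
  "hilb1 R I n = (\<Sum>j=0..n. hilb0 R I j)"

definition e0 :: "('a, 'b) ring_scheme \<Rightarrow> 'a set \<Rightarrow> int" where
  "e0 R I = (THE e. \<forall>\<^sub>F n in sequentially. int (hilb0 R I n) = e)"

definition e1 :: "('a, 'b) ring_scheme \<Rightarrow> 'a set \<Rightarrow> int" where
  "e1 R I =
    (THE e. \<forall>\<^sub>F n in sequentially. int (hilb1 R I n) = e0 R I * (int n + 1) - e)"

definition postulation_number :: "('a, 'b) ring_scheme \<Rightarrow> 'a set \<Rightarrow> nat" where
  "postulation_number R I = (LEAST p. \<forall>n\<ge>p. int (hilb0 R I n) = e0 R I)"

definition stability :: "('a, 'b) ring_scheme \<Rightarrow> 'a set \<Rightarrow> enat" where
  "stability R m = (SUP I\<in>{I. primary_to R m I}. enat (postulation_number R I))"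

definition colength :: "('a, 'b) ring_scheme \<Rightarrow> 'a set \<Rightarrow> nat" where
  "colength R I = quot_length R (carrier R) I"

definition conormal_length :: "('a, 'b) ring_scheme \<Rightarrow> 'a set \<Rightarrow> nat" where
  "conormal_length R I = quot_length R I (ideal_power R I 2)"

text \<open>Since \<open>hilb0 R I n \<le> e0 R I\<close> for \<open>\<mm>\<close>-primary ideals, the three cases are exhaustive.\<close>

definition beta :: "('a, 'b) ring_scheme \<Rightarrow> 'a set \<Rightarrow> int" where
  "beta R I =
    (if e0 R I = int (colength R I) then 0
     else if e0 R I = int (conormal_length R I) then 1
     else if e0 R I > int (conormal_length R I) then
       e1 R I - 2 * e0 R I + int (colength R I) + int (conormal_length R I) + 2
     else undefined)"

end

theory Submission
  imports Defs
begin

text \<open>The maximal ideal contains a nonzerodivisor, and dimension one forces \<open>R/a\<close> to have finite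
  length for every nonzerodivisor \<open>a \<in> \<mm>\<close>. Additivity of length gives
  \<open>\<ell>(J/aJ) = \<ell>(R/a)\<close> for all ideals \<open>J\<close> containing a nonzerodivisor. Applied to \<open>J = I\<^sup>n\<close> and
  \<open>a = y\<close> with \<open>y I\<^sup>k = I\<^sup>k\<^sup>+\<^sup>1\<close> for some \<open>k\<close>, it shows that \<open>\<ell>(R/y) - H\<^sup>0\<^sub>I(n)\<close> is the length of
  \<open>I\<^sup>n\<^sup>+\<^sup>1/yI\<^sup>n\<close>; hence \<open>e\<^sub>0(I) = \<ell>(R/y)\<close>, and \<open>H\<^sup>0\<^sub>I(n) = e\<^sub>0(I)\<close> holds exactly when
  \<open>I\<^sup>n\<^sup>+\<^sup>1 = yI\<^sup>n\<close>, a condition that persists as \<open>n\<close> grows. As the minimal reductions are the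
  ideals \<open>(y)\<close>, this is \<open>r(I) = pn(I)\<close>, and \<open>e\<^sub>1(I)\<close> is the sum of the \<open>pn(I)\<close> positive defects
  \<open>e\<^sub>0(I) - H\<^sup>0\<^sub>I(n)\<close>, which gives (ii).

  Such \<open>y\<close> come from the Eakin-Sathaye argument: if \<open>\<ell>(I\<^sup>n/aI\<^sup>n) \<le> n\<close> for some \<open>a \<in> \<mm>\<close>, then
  \<open>I\<^sup>n = yI\<^sup>n\<^sup>-\<^sup>1\<close> for some \<open>y \<in> I\<close>. The length on the left is \<open>\<ell>(R/a)\<close>, and taking \<open>a\<close> to be a
  principal reduction of \<open>\<mm>\<close> gives \<open>pn(I) \<le> e\<^sub>0(R) - 1\<close>.\<close>

section \<open>Lengths of chains\<close>

no_notation Sum_Type.Plus (infixr \<open><+>\<close> 65)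

definition chain_of_length :: "'a set set \<Rightarrow> nat \<Rightarrow> bool" where
  "chain_of_length S n \<longleftrightarrow>
    (\<exists>N. (\<forall>i\<le>n. N i \<in> S) \<and> (\<forall>i<n. N i \<subset> N (Suc i)))"

text \<open>Module length and Krull dimension are both suprema of this form, with \<open>S\<close>
  the submodules or the prime ideals, so facts about chains are proved once for both.\<close>

definition chain_length :: "'a set set \<Rightarrow> enat" where
  "chain_length S = Sup (enat ` {n. chain_of_length S n})"

lemma chain_length_eq:
  "Sup {enat n |n N. (\<forall>i\<le>n. P (N i)) \<and> (\<forall>i<n. N i \<subset> N (Suc i))} = chain_length {A. P A}"
  unfolding chain_length_def chain_of_length_def by (rule arg_cong[of _ _ Sup]) auto

lemma module_length_eq: "module_length R M = chain_length {N. submodule N R M}"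
  unfolding module_length_def by (rule chain_length_eq[of "\<lambda>N. submodule N R M"])

lemma krull_dim_eq: "krull_dim R = chain_length {P. primeideal P R}"
  unfolding krull_dim_def by (rule chain_length_eq[of "\<lambda>P. primeideal P R"])

lemma chain_of_length_mono: "chain_of_length S n \<Longrightarrow> k \<le> n \<Longrightarrow> chain_of_length S k"
  unfolding chain_of_length_def by (meson order.trans order.strict_trans2)

lemma chain_of_length_0: "S \<noteq> {} \<Longrightarrow> chain_of_length S 0"
  unfolding chain_of_length_def by auto

lemma chain_of_length_le: "chain_of_length S n \<Longrightarrow> enat n \<le> chain_length S"
  unfolding chain_length_def by (simp add: Sup_upper)

text \<open>Truncating a chain realizes all shorter lengths, so a supremum of at least
  \<open>n\<close> yields a chain of length \<open>n\<close>, also when the supremum is infinite.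
  For empty \<open>S\<close> the supremum is 0 although there is no chain at all.\<close>

lemma enat_le_chain_length_iff:
  assumes "S \<noteq> {}"
  shows "enat n \<le> chain_length S \<longleftrightarrow> chain_of_length S n"
proof
  assume le: "enat n \<le> chain_length S"
  show "chain_of_length S n"
  proof (rule ccontr)
    assume no: "\<not> chain_of_length S n"
    then obtain k where n: "n = Suc k"
      using chain_of_length_0[OF assms] by (cases n) auto
    have "chain_length S \<le> enat k"
      unfolding chain_length_def
    proof (rule Sup_least, clarify)
      fix l assume "chain_of_length S l"
      then have "\<not> n \<le> l" using no chain_of_length_mono by blast
      then show "enat l \<le> enat k" using n by simp
    qed
    with le n show False using order.trans by fastforce
  qed
qed (rule chain_of_length_le)

text \<open>Comparing finite lower bounds treats finite and infinite values at once; with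
  \<open>enat_le_len_iff\<close> an inequality of lengths becomes a statement about a single
  chain.\<close>

lemma enat_leI:
  assumes "\<And>n. enat n \<le> x \<Longrightarrow> enat n \<le> y"
  shows "x \<le> y"
proof (cases x)
  case infinity
  then have "enat n \<le> y" for n using assms by simp
  then have "y = \<infinity>" by (metis Suc_ile_eq enat.exhaust enat_ord_simps(5) less_irrefl infinity_ileE)
  then show ?thesis by simp
qed (use assms in auto)

text \<open>Strictly monotone maps carry chains to chains. Two such maps in opposite directions
  prove equality of lengths without a bijection.\<close>

lemma chain_length_mono_map:
  assumes "\<And>A. A \<in> S \<Longrightarrow> f A \<in> T"
    and "\<And>A B. A \<in> S \<Longrightarrow> B \<in> S \<Longrightarrow> A \<subset> B \<Longrightarrow> f A \<subset> f B"
  shows "chain_length S \<le> chain_length T"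
  unfolding chain_length_def
proof (rule Sup_subset_mono, clarify)
  fix n assume "chain_of_length S n"
  then obtain N where "\<forall>i\<le>n. N i \<in> S" "\<forall>i<n. N i \<subset> N (Suc i)"
    unfolding chain_of_length_def by blast
  then have "(\<forall>i\<le>n. (f \<circ> N) i \<in> T) \<and> (\<forall>i<n. (f \<circ> N) i \<subset> (f \<circ> N) (Suc i))"
    using assms by (simp add: Suc_leI)
  then have "chain_of_length T n" unfolding chain_of_length_def by blast
  then show "enat n \<in> enat ` {n. chain_of_length T n}" by blast
qed

text \<open>Every chain in \<open>S\<close> is prolonged by putting \<open>Y\<close> on top.\<close>

lemma chain_length_extend:
  assumes "S \<noteq> {}" "S \<subseteq> T" "Y \<in> T" "\<And>A. A \<in> S \<Longrightarrow> A \<subset> Y"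
  shows "chain_length S + 1 \<le> chain_length T"
proof -
  have ext: "chain_of_length T (Suc n)" if "chain_of_length S n" for n
  proof -
    obtain N where N: "\<forall>i\<le>n. N i \<in> S" "\<forall>i<n. N i \<subset> N (Suc i)"
      using \<open>chain_of_length S n\<close> unfolding chain_of_length_def by blast
    let ?N = "N(Suc n := Y)"
    have "(\<forall>i\<le>Suc n. ?N i \<in> T) \<and> (\<forall>i<Suc n. ?N i \<subset> ?N (Suc i))"
      using N assms by (auto simp: less_Suc_eq le_Suc_eq)
    then show ?thesis unfolding chain_of_length_def by blast
  qed
  \<comment> \<open>Successor commutes with suprema of nonempty sets, and the chain of length 0
    makes this one nonempty.\<close>
  have "eSuc (chain_length S) = Sup (eSuc ` enat ` {n. chain_of_length S n})"
    unfolding chain_length_def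
    by (rule eSuc_Sup) (use chain_of_length_0[OF assms(1)] in auto)
  also have "\<dots> \<le> chain_length T"
    by (rule Sup_least) (auto simp: eSuc_enat intro!: chain_of_length_le[OF ext])
  finally show ?thesis by (simp add: plus_1_eSuc)
qed


section \<open>Length of quotients of ideals\<close>

context cring
begin

section \<open>Arithmetic of ideals in a commutative ring\<close>

lemma ideal_cringI:
  assumes "H \<subseteq> carrier R" "\<zero> \<in> H"
    and add: "\<And>x y. x \<in> H \<Longrightarrow> y \<in> H \<Longrightarrow> x \<oplus> y \<in> H"
    and mult: "\<And>r x. r \<in> carrier R \<Longrightarrow> x \<in> H \<Longrightarrow> r \<otimes> x \<in> H"
  shows "ideal H R"
proof (rule idealI)
  \<comment> \<open>Negation is multiplication by \<open>\<ominus> \<one>\<close>.\<close>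
  have neg: "\<ominus> x \<in> H" if "x \<in> H" for x
    using mult[of "\<ominus> \<one>" x] that assms(1) l_minus[of \<one> x] by auto
  then show "subgroup H (add_monoid R)"
    unfolding subgroup_def using assms by (auto simp flip: a_inv_def)
  show "x \<otimes> a \<in> H" if "a \<in> H" "x \<in> carrier R" for a x
    using that mult by blast
  show "a \<otimes> x \<in> H" if "a \<in> H" "x \<in> carrier R" for a x
    using that mult assms(1) m_comm[of a x] by auto
qed (rule ring_axioms)

lemma mem_set_add_iff: "x \<in> A <+> B \<longleftrightarrow> (\<exists>a\<in>A. \<exists>b\<in>B. x = a \<oplus> b)"
  unfolding set_add_def' by auto

lemma ideal_zero: "ideal A R \<Longrightarrow> \<zero> \<in> A"
  by (simp add: additive_subgroup.zero_closed ideal.axioms(1))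

lemma ideal_add: "ideal A R \<Longrightarrow> x \<in> A \<Longrightarrow> y \<in> A \<Longrightarrow> x \<oplus> y \<in> A"
  by (simp add: additive_subgroup.a_closed ideal.axioms(1))

lemma ideal_neg: "ideal A R \<Longrightarrow> x \<in> A \<Longrightarrow> \<ominus> x \<in> A"
  by (simp add: additive_subgroup.a_inv_closed ideal.axioms(1))

lemma ideal_minus: "ideal A R \<Longrightarrow> x \<in> A \<Longrightarrow> y \<in> A \<Longrightarrow> x \<ominus> y \<in> A"
  by (simp add: a_minus_def ideal_add ideal_neg)

lemma ideal_subset: "ideal A R \<Longrightarrow> A \<subseteq> carrier R"
  by (rule subsetI) (rule ideal.Icarr)

lemma ideal_sum_left:
  assumes "ideal A R" "ideal B R"
  shows "A \<subseteq> A <+> B"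
proof
  fix x assume x: "x \<in> A"
  then have "x = x \<oplus> \<zero>" using assms(1) by (simp add: ideal.Icarr)
  then show "x \<in> A <+> B" using x ideal_zero[OF assms(2)] unfolding mem_set_add_iff by blast
qed

lemma ideal_sum_right:
  assumes "ideal A R" "ideal B R"
  shows "B \<subseteq> A <+> B"
proof
  fix x assume x: "x \<in> B"
  then have "x = \<zero> \<oplus> x" using assms(2) by (simp add: ideal.Icarr)
  then show "x \<in> A <+> B" using x ideal_zero[OF assms(1)] unfolding mem_set_add_iff by blast
qed

lemma ideal_sum_least: "ideal C R \<Longrightarrow> A \<subseteq> C \<Longrightarrow> B \<subseteq> C \<Longrightarrow> A <+> B \<subseteq> C"
  by (auto simp: mem_set_add_iff intro!: ideal_add[of C])

lemma set_add_mono: "A \<subseteq> B \<Longrightarrow> A <+> K \<subseteq> B <+> K"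
  unfolding set_add_def' by (intro UN_mono) auto

text \<open>Modular law: if \<open>b\<close> in \<open>B\<close> is written \<open>a + k\<close>,
  then \<open>k = b - a\<close> lies in \<open>B \<inter> K = A \<inter> K\<close>, so
  \<open>b\<close> lies in \<open>A\<close>.\<close>

lemma ideal_modular_eq:
  assumes "ideal A R" "ideal B R" "ideal K R" "A \<subseteq> B" "A \<inter> K = B \<inter> K" "A <+> K = B <+> K"
  shows "A = B"
proof
  show "B \<subseteq> A"
  proof
    fix b assume b: "b \<in> B"
    then have "b \<in> A <+> K" using assms(2,3,6) ideal_sum_left[of B K] by blast
    then obtain a k where ak: "a \<in> A" "k \<in> K" "b = a \<oplus> k"
      by (auto simp: mem_set_add_iff)
    have car: "a \<in> carrier R" "k \<in> carrier R" using ak assms(1,3) by (auto intro: ideal.Icarr)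
    have "b \<ominus> a = (k \<oplus> a) \<oplus> \<ominus> a" using car by (simp add: a_minus_def ak(3) a_comm)
    then have "k = b \<ominus> a" using car by (simp add: a_assoc r_neg)
    then have "k \<in> A" using b ak assms(4,5) ideal_minus[OF assms(2), of b a] by blast
    then show "b \<in> A" using ak ideal_add[OF assms(1)] by auto
  qed
qed (rule assms)

definition ideal_interval :: "'a set \<Rightarrow> 'a set \<Rightarrow> 'a set set" where
  "ideal_interval J K = {N. ideal N R \<and> J \<subseteq> N \<and> N \<subseteq> K}"

text \<open>The length of \<open>K/J\<close>, read off from the ideals in between and allowed to be
  infinite; \<open>quot_length_eq\<close> translates it to the module of cosets.\<close>

definition len :: "'a set \<Rightarrow> 'a set \<Rightarrow> enat" where
  "len J K = chain_length (ideal_interval J K)"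

lemma enat_le_len_iff:
  "ideal J R \<Longrightarrow> J \<subseteq> K \<Longrightarrow> enat n \<le> len J K \<longleftrightarrow> chain_of_length (ideal_interval J K) n"
  unfolding len_def by (rule enat_le_chain_length_iff) (auto simp: ideal_interval_def)

lemma len_mono: "J' \<subseteq> J \<Longrightarrow> K \<subseteq> K' \<Longrightarrow> len J K \<le> len J' K'"
  unfolding len_def
  by (rule chain_length_mono_map[where f = id]) (auto simp: ideal_interval_def)

lemma len_strict_mono:
  assumes "ideal J R" "ideal X R" "ideal Y R" "J \<subseteq> X" "X \<subset> Y"
  shows "len J X + 1 \<le> len J Y"
  unfolding len_def
  by (rule chain_length_extend[where Y = Y]) (use assms in \<open>auto simp: ideal_interval_def\<close>)

text \<open>Each step of a chain from \<open>K\<close> to \<open>L\<close> raises the length over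
  \<open>J\<close> by at least one, starting from at least \<open>len J K\<close>.\<close>

lemma len_add_le:
  assumes J: "ideal J R" "J \<subseteq> K" and K: "ideal K R" "K \<subseteq> L"
  shows "len J K + len K L \<le> len J L"
proof -
  have step: "len J K + enat q \<le> len J L" if q: "enat q \<le> len K L" for q
  proof -
    obtain M where M: "\<forall>i\<le>q. M i \<in> ideal_interval K L" "\<forall>i<q. M i \<subset> M (Suc i)"
      using q unfolding enat_le_len_iff[OF K] chain_of_length_def by blast
    have "i \<le> q \<Longrightarrow> len J K + enat i \<le> len J (M i)" for i
    proof (induction i)
      case 0
      then show ?case using M len_mono[of J J K "M 0"] by (auto simp: ideal_interval_def zero_enat_def[symmetric])
    next
      case (Suc i)
      have "len J K + enat (Suc i) = len J K + enat i + 1"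
        by (simp add: add.assoc one_enat_def)
      also have "\<dots> \<le> len J (M i) + 1" using Suc by (simp add: add_right_mono)
      also have "\<dots> \<le> len J (M (Suc i))"
      proof -
        have "M i \<in> ideal_interval K L" "M (Suc i) \<in> ideal_interval K L" "M i \<subset> M (Suc i)"
          using M Suc.prems by auto
        then show ?thesis using J by (intro len_strict_mono) (auto simp: ideal_interval_def)
      qed
      finally show ?case .
    qed
    from this[of q] show ?thesis
      using M len_mono[of J J "M q" L] by (force simp: ideal_interval_def)
  qed
  \<comment> \<open>The bound for all finite \<open>q\<close> passes to \<open>len K L\<close>. If
    \<open>len J K\<close> is infinite, \<open>q = 0\<close> already suffices.\<close>
  show ?thesis
  proof (cases "len J K = \<infinity> \<or> len J L = \<infinity>")
    case True
    then show ?thesis using step[of 0] by (auto simp: zero_enat_def[symmetric])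
  next
    case False
    then obtain a c where ac: "len J K = enat a" "len J L = enat c" by auto
    have "len K L \<le> enat (c - a)"
      by (rule enat_leI) (use step ac in force)
    moreover have "a \<le> c" using step[of 0] ac by (simp add: zero_enat_def[symmetric])
    ultimately show ?thesis using ac by (cases "len K L") auto
  qed
qed

text \<open>Send a chain \<open>N\<close> to the chains \<open>N \<inter> K\<close> and \<open>N + K\<close>: by modularity, at least one of them
  grows at each step.\<close>

lemma len_add:
  assumes J: "ideal J R" "J \<subseteq> K" and K: "ideal K R" "K \<subseteq> L" and L: "ideal L R"
  shows "len J L = len J K + len K L"
proof (rule antisym)
  show "len J L \<le> len J K + len K L"
  proof (rule enat_leI)
    fix n assume "enat n \<le> len J L"
    then obtain N where N: "\<forall>i\<le>n. N i \<in> ideal_interval J L" "\<forall>i<n. N i \<subset> N (Suc i)"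
      unfolding enat_le_len_iff[OF J(1) order.trans[OF J(2) K(2)]] chain_of_length_def by blast
    have id: "ideal (N i) R" "J \<subseteq> N i" "N i \<subseteq> L" "ideal (N i \<inter> K) R" "ideal (N i <+> K) R"
      "J \<subseteq> N i \<inter> K" "N i <+> K \<subseteq> L" "K \<subseteq> N i <+> K" if "i \<le> n" for i
    proof -
      show i: "ideal (N i) R" "J \<subseteq> N i" "N i \<subseteq> L"
        using N(1) that by (auto simp: ideal_interval_def)
      show "ideal (N i \<inter> K) R" "ideal (N i <+> K) R"
        using i_intersect[OF i(1) K(1)] add_ideals[OF i(1) K(1)] by auto
      show "J \<subseteq> N i \<inter> K" using i(2) J(2) by blast
      show "N i <+> K \<subseteq> L" by (rule ideal_sum_least[OF L i(3) K(2)])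
      show "K \<subseteq> N i <+> K" by (rule ideal_sum_right[OF i(1) K(1)])
    qed
    have "i \<le> n \<Longrightarrow> enat i \<le> len J (N i \<inter> K) + len K (N i <+> K)" for i
    proof (induction i)
      case (Suc i)
      let ?A = "N i" and ?B = "N (Suc i)"
      have sub: "?A \<subset> ?B" using N Suc.prems by simp
      note idA = id[OF Suc_leD[OF Suc.prems]] and idB = id[OF Suc.prems]
      then have sub': "?A \<inter> K \<subseteq> ?B \<inter> K" "?A <+> K \<subseteq> ?B <+> K"
        using set_add_mono[OF psubset_imp_subset[OF sub]] psubset_imp_subset[OF sub] by blast+
      have m: "len J (?A \<inter> K) \<le> len J (?B \<inter> K)" "len K (?A <+> K) \<le> len K (?B <+> K)"
        using sub' by (auto intro: len_mono)
      have "?A \<inter> K \<subset> ?B \<inter> K \<or> ?A <+> K \<subset> ?B <+> K"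
        using ideal_modular_eq[OF idA(1) idB(1) K(1)] sub sub' by blast
      then have "len J (?A \<inter> K) + len K (?A <+> K) + 1 \<le> len J (?B \<inter> K) + len K (?B <+> K)"
      proof
        assume "?A \<inter> K \<subset> ?B \<inter> K"
        then have "len J (?A \<inter> K) + 1 \<le> len J (?B \<inter> K)"
          using len_strict_mono[OF J(1) idA(4) idB(4) idA(6)] by blast
        from add_mono[OF this m(2)] show ?thesis by (simp add: ac_simps)
      next
        assume "?A <+> K \<subset> ?B <+> K"
        then have "len K (?A <+> K) + 1 \<le> len K (?B <+> K)"
          using len_strict_mono[OF K(1) idA(5) idB(5) idA(8)] by blast
        from add_mono[OF m(1) this] show ?thesis by (simp add: ac_simps)
      qed
      moreover have "enat (Suc i) \<le> len J (?A \<inter> K) + len K (?A <+> K) + 1"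
        using Suc add_right_mono[of "enat i" _ 1] by (simp add: one_enat_def)
      ultimately show ?case by (rule order.trans[rotated])
    qed (simp add: zero_enat_def[symmetric])
    from this[of n] have "enat n \<le> len J (N n \<inter> K) + len K (N n <+> K)" by simp
    also have "\<dots> \<le> len J K + len K L"
      using id(7)[of n] by (intro add_mono len_mono) auto
    finally show "enat n \<le> len J K + len K L" .
  qed
qed (rule len_add_le[OF J K])

lemma len_eq_0_iff:
  assumes "ideal J R" "ideal K R" "J \<subseteq> K"
  shows "len J K = 0 \<longleftrightarrow> J = K"
proof
  assume "len J K = 0"
  then show "J = K"
    using len_strict_mono[of J J K] assms by (cases "J = K") auto
next
  assume "J = K"
  moreover have "n = 0" if chain: "chain_of_length (ideal_interval J J) n" for n
  proof (rule ccontr)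
    assume "n \<noteq> 0"
    moreover obtain N where "\<forall>i\<le>n. N i \<in> ideal_interval J J" "\<forall>i<n. N i \<subset> N (Suc i)"
      using chain unfolding chain_of_length_def by blast
    ultimately have "N 0 \<in> ideal_interval J J" "N 1 \<in> ideal_interval J J" "N 0 \<subset> N 1"
      by auto
    then show False by (auto simp: ideal_interval_def)
  qed
  ultimately have "len J K \<le> 0"
    unfolding len_def chain_length_def by (auto intro!: Sup_least simp: zero_enat_def)
  then show "len J K = 0" by simp
qed

text \<open>A strict enlargement would raise the finite length by one.\<close>

lemma len_finite_eq:
  assumes "ideal J R" "ideal X R" "ideal Y R" "J \<subseteq> X" "X \<subseteq> Y"
    and "len J Y \<le> len J X" "len J X \<noteq> \<infinity>"
  shows "X = Y"
proof (rule ccontr)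
  assume "X \<noteq> Y"
  then have "len J X + 1 \<le> len J Y" using assms by (intro len_strict_mono) auto
  then show False using assms(6,7) by (cases "len J X"; cases "len J Y") (auto simp: one_enat_def)
qed

text \<open>The correspondence theorem: submodules of the coset module \<open>I/J\<close> match the
  ideals between \<open>J\<close> and \<open>I\<close>. Preimage and image are both strictly
  monotone, which is enough for equal chain lengths.\<close>

lemma quot_length_eq:
  assumes J: "ideal J R" and I: "ideal I R" and sub: "J \<subseteq> I"
  shows "quot_length R I J = the_enat (len J I)"
proof -
  let ?Q = "quot_module (ideal_module R I) J"
  have car: "x \<in> carrier R" if "x \<in> I" for x using ideal.Icarr[OF I that] .
  have carQ: "carrier ?Q = (\<lambda>x. J +> x) ` I"
    by (auto simp: quot_module_def ideal_module_def A_RCOSETS_def' a_r_coset_def')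
  have zeroQ: "\<zero>\<^bsub>?Q\<^esub> = J" by (simp add: quot_module_def)
  have zero_coset: "J +> \<zero> = J"
    using ideal_subset[OF J] by (simp add: a_coset_add_zero)
  have addQ: "(J +> x) \<oplus>\<^bsub>?Q\<^esub> (J +> y) = J +> (x \<oplus> y)" if "x \<in> I" "y \<in> I" for x y
  proof -
    have "(J +> x) \<oplus>\<^bsub>?Q\<^esub> (J +> y) = (J +> x) <+> (J +> y)"
      by (simp add: quot_module_def ideal_module_def set_add_def')
    then show ?thesis using ideal.a_rcos_sum[OF J] that car by simp
  qed
  have coset_eq: "J +> x = J +> y \<longleftrightarrow> x \<ominus> y \<in> J" if "x \<in> I" "y \<in> I" for x y
    using quotient_eq_iff_same_a_r_cos[OF J, of x y] that car by simp
  \<comment> \<open>Scalar multiplication is a union over all representatives; it collapses to one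
    coset because changing the representative changes \<open>r \<otimes> y\<close> by an element of
    \<open>J\<close>.\<close>
  have smultQ: "r \<odot>\<^bsub>?Q\<^esub> (J +> x) = J +> (r \<otimes> x)" if r: "r \<in> carrier R" and x: "x \<in> I" for r x
  proof -
    have "J +> (r \<otimes> y) = J +> (r \<otimes> x)" if y: "y \<in> J +> x" for y
    proof -
      obtain h where h: "h \<in> J" "y = h \<oplus> x" using y by (auto simp: a_r_coset_def')
      then have y': "y \<in> I" using x sub ideal_add[OF I] by auto
      have c: "h \<in> carrier R" "x \<in> carrier R" "y \<in> carrier R" using h(1) x y' sub car by auto
      have "r \<otimes> y \<ominus> r \<otimes> x = r \<otimes> h"
        using c r h(2) by (simp add: r_distr a_minus_def a_assoc r_neg)
      then have "r \<otimes> y \<ominus> r \<otimes> x \<in> J" using J h r by (simp add: ideal.I_l_closed)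
      then show ?thesis using coset_eq[of "r \<otimes> y" "r \<otimes> x"] I r x y' by (simp add: ideal.I_l_closed)
    qed
    moreover have "x \<in> J +> x" using J x car ideal_zero[OF J] by (force simp: a_r_coset_def')
    ultimately have "(\<Union>y\<in>J +> x. J +> (r \<otimes> y)) = J +> (r \<otimes> x)" by blast
    then show ?thesis by (simp add: quot_module_def ideal_module_def a_r_coset_def')
  qed
  \<comment> \<open>The inverse is a definite description in the monoid of cosets, so existence and
    uniqueness are checked directly.\<close>
  have invQ: "inv\<^bsub>add_monoid ?Q\<^esub> (J +> x) = J +> (\<ominus> x)" if x: "x \<in> I" for x
    unfolding m_inv_def
  proof (rule the_equality)
    have nx: "\<ominus> x \<in> I" using x ideal_neg[OF I] by auto
    have "x \<oplus> \<ominus> x = \<zero>" "\<ominus> x \<oplus> x = \<zero>" using x car by (auto simp: r_neg l_neg)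
    then show "J +> \<ominus> x \<in> carrier (add_monoid ?Q) \<and>
        (J +> x) \<otimes>\<^bsub>add_monoid ?Q\<^esub> (J +> \<ominus> x) = \<one>\<^bsub>add_monoid ?Q\<^esub> \<and>
        (J +> \<ominus> x) \<otimes>\<^bsub>add_monoid ?Q\<^esub> (J +> x) = \<one>\<^bsub>add_monoid ?Q\<^esub>"
      using nx x by (simp add: carQ addQ zeroQ zero_coset)
    fix Y assume Y: "Y \<in> carrier (add_monoid ?Q) \<and>
        (J +> x) \<otimes>\<^bsub>add_monoid ?Q\<^esub> Y = \<one>\<^bsub>add_monoid ?Q\<^esub> \<and>
        Y \<otimes>\<^bsub>add_monoid ?Q\<^esub> (J +> x) = \<one>\<^bsub>add_monoid ?Q\<^esub>"
    then obtain y where y: "y \<in> I" "Y = J +> y" by (auto simp: carQ)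
    then have "J +> (x \<oplus> y) = J +> \<zero>" using Y x by (simp add: addQ zeroQ zero_coset)
    then have "(x \<oplus> y) \<ominus> \<zero> \<in> J"
      using coset_eq[of "x \<oplus> y" \<zero>] x y ideal_add[OF I] ideal_zero[OF I] by simp
    moreover have "(x \<oplus> y) \<ominus> \<zero> = y \<ominus> (\<ominus> x)"
      using x y car by (simp add: a_minus_def a_comm)
    ultimately show "Y = J +> \<ominus> x" using coset_eq[of y "\<ominus> x"] y nx by simp
  qed
  have "module_length R ?Q = len J I"
    unfolding module_length_eq len_def
  proof (rule antisym)
    show "chain_length {N. submodule N R ?Q} \<le> chain_length (ideal_interval J I)"
    proof (rule chain_length_mono_map[where f = "\<lambda>H. {x \<in> I. J +> x \<in> H}"])
      fix H assume "H \<in> {N. submodule N R ?Q}"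
      then interpret H: submodule H R ?Q by simp
      have J_H: "J \<in> H" using H.one_closed by (simp add: zeroQ)
      have "ideal {x \<in> I. J +> x \<in> H} R"
      proof (rule ideal_cringI)
        show "\<zero> \<in> {x \<in> I. J +> x \<in> H}" using ideal_zero[OF I] J_H by (simp add: zero_coset)
        show "x \<oplus> y \<in> {x \<in> I. J +> x \<in> H}"
          if "x \<in> {x \<in> I. J +> x \<in> H}" "y \<in> {x \<in> I. J +> x \<in> H}" for x y
          using that H.m_closed[of "J +> x" "J +> y"] ideal_add[OF I] by (simp add: addQ)
        show "r \<otimes> x \<in> {x \<in> I. J +> x \<in> H}"
          if "r \<in> carrier R" "x \<in> {x \<in> I. J +> x \<in> H}" for r x
          using that H.smult_closed[of r "J +> x"] ideal.I_l_closed[OF I] by (simp add: smultQ)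
      qed (use car in blast)
      moreover have "J \<subseteq> {x \<in> I. J +> x \<in> H}"
      proof
        fix x assume x: "x \<in> J"
        then have "x \<in> I" "\<zero> \<in> I" "x \<ominus> \<zero> \<in> J"
          using sub ideal_zero[OF I] ideal_zero[OF J] ideal_minus[OF J x] by auto
        then have "J +> x = J" using coset_eq[of x \<zero>] zero_coset by simp
        then show "x \<in> {x \<in> I. J +> x \<in> H}" using \<open>x \<in> I\<close> J_H by simp
      qed
      ultimately show "{x \<in> I. J +> x \<in> H} \<in> ideal_interval J I"
        by (auto simp: ideal_interval_def)
    next
      fix H H' assume H: "H \<in> {N. submodule N R ?Q}" "H' \<in> {N. submodule N R ?Q}" "H \<subset> H'"
      then obtain X where X: "X \<in> H'" "X \<notin> H" by blast
      have "subgroup H' (add_monoid ?Q)" using H(2) by (simp add: submodule_def)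
      then have "X \<in> carrier ?Q" using X(1) subgroup.subset by fastforce
      then obtain x where "x \<in> I" "X = J +> x" by (auto simp: carQ)
      then show "{x \<in> I. J +> x \<in> H} \<subset> {x \<in> I. J +> x \<in> H'}" using X H(3) by blast
    qed
    show "chain_length (ideal_interval J I) \<le> chain_length {N. submodule N R ?Q}"
    proof (rule chain_length_mono_map[where f = "\<lambda>K. (\<lambda>x. J +> x) ` K"])
      fix K assume "K \<in> ideal_interval J I"
      then have K: "ideal K R" "J \<subseteq> K" "K \<subseteq> I" by (auto simp: ideal_interval_def)
      have "submodule ((\<lambda>x. J +> x) ` K) R ?Q"
      proof (intro submodule.intro subgroup.intro submodule_axioms.intro)
        show "(+>) J ` K \<subseteq> carrier (add_monoid ?Q)" using K by (auto simp: carQ)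
        show "X \<otimes>\<^bsub>add_monoid ?Q\<^esub> Y \<in> (+>) J ` K" if "X \<in> (+>) J ` K" "Y \<in> (+>) J ` K" for X Y
          using that K ideal_add[OF K(1)] by (auto simp: addQ subset_iff)
        show "\<one>\<^bsub>add_monoid ?Q\<^esub> \<in> (+>) J ` K"
          using ideal_zero[OF K(1)] zero_coset by (force simp: zeroQ)
        show "inv\<^bsub>add_monoid ?Q\<^esub> X \<in> (+>) J ` K" if "X \<in> (+>) J ` K" for X
          using that K ideal_neg[OF K(1)] by (auto simp: invQ subset_iff)
        show "r \<odot>\<^bsub>?Q\<^esub> X \<in> (+>) J ` K" if "r \<in> carrier R" "X \<in> (+>) J ` K" for r X
          using that K ideal.I_l_closed[OF K(1)] by (auto simp: smultQ subset_iff)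
      qed
      then show "(+>) J ` K \<in> {N. submodule N R ?Q}" by simp
    next
      fix K L assume KL: "K \<in> ideal_interval J I" "L \<in> ideal_interval J I" "K \<subset> L"
      then have K: "ideal K R" "J \<subseteq> K" "K \<subseteq> I" and L: "L \<subseteq> I" by (auto simp: ideal_interval_def)
      obtain x where x: "x \<in> L" "x \<notin> K" using KL(3) by blast
      \<comment> \<open>Since \<open>K\<close> contains \<open>J\<close>, it is a union of cosets,
        and an element outside \<open>K\<close> has its coset outside the image of
        \<open>K\<close>.\<close>
      have "J +> x \<notin> (+>) J ` K"
      proof
        assume "J +> x \<in> (+>) J ` K"
        then obtain y where y: "y \<in> K" "J +> x = J +> y" by blast
        then have "x \<ominus> y \<in> K" using coset_eq[of x y] x K L by blast
        then have "(x \<ominus> y) \<oplus> y \<in> K" using y ideal_add[OF K(1)] by auto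
        moreover have "(x \<ominus> y) \<oplus> y = x"
          using x y K L car by (simp add: a_minus_def a_assoc l_neg subset_iff)
        ultimately show False using x by simp
      qed
      then show "(+>) J ` K \<subset> (+>) J ` L" using x KL(3) by blast
    qed
  qed
  then show ?thesis by (simp add: quot_length_def)
qed


subsection \<open>Powers and multiples of ideals\<close>

lemma ideal_power_0 [simp]: "ideal_power R I 0 = carrier R"
  by (simp add: ideal_power_def ideals_set_def)

lemma ideal_power_Suc: "ideal_power R I (Suc n) = ideal_power R I n \<cdot> I"
  by (simp add: ideal_power_def ideals_set_def)

lemma ideal_ideal_power [intro]: "ideal I R \<Longrightarrow> ideal (ideal_power R I n) R"
  by (induction n) (auto simp: ideal_power_Suc oneideal intro: ideal_prod_is_ideal)

lemma ideal_power_1: "ideal I R \<Longrightarrow> ideal_power R I (Suc 0) = I"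
  by (simp add: ideal_power_Suc ideal_prod_commute[OF oneideal] ideal_prod_one)

lemma ideal_power_add:
  assumes "ideal I R"
  shows "ideal_power R I (k + n) = ideal_power R I k \<cdot> ideal_power R I n"
proof (induction n)
  case 0
  then show ?case using ideal_prod_one[OF ideal_ideal_power[OF assms]] by simp
next
  case (Suc n)
  then show ?case
    by (simp add: ideal_power_Suc ideal_prod_assoc ideal_ideal_power assms)
qed

lemma ideal_prod_least:
  assumes "ideal C R" "\<And>x y. x \<in> A \<Longrightarrow> y \<in> B \<Longrightarrow> x \<otimes> y \<in> C"
  shows "A \<cdot> B \<subseteq> C"
proof
  fix s assume "s \<in> A \<cdot> B"
  then show "s \<in> C"
    by (induction rule: ideal_prod.induct) (auto intro: assms ideal_add[OF assms(1)])
qed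

lemma mult_mem_ideal_power:
  assumes "ideal I R" "x \<in> ideal_power R I k" "y \<in> ideal_power R I n"
  shows "x \<otimes> y \<in> ideal_power R I (k + n)"
  using assms by (simp add: ideal_power_add ideal_prod.prod)

lemma ideal_power_antimono:
  assumes "ideal I R" "k \<le> n"
  shows "ideal_power R I n \<subseteq> ideal_power R I k"
proof -
  have "ideal_power R I (k + (n - k)) \<subseteq> ideal_power R I k"
    unfolding ideal_power_add[OF assms(1)]
    using ideal_prod_inter[OF ideal_ideal_power[OF assms(1)] ideal_ideal_power[OF assms(1)]]
    by blast
  then show ?thesis using assms(2) by simp
qed

text \<open>The product of \<open>(c)\<close> and \<open>A\<close>, kept as an image so that each
  element has the form \<open>c \<otimes> x\<close> and no finite sums occur;
  \<open>cgenideal_prod_eq\<close> links it to the ideal product.\<close>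

definition mult_ideal :: "'a \<Rightarrow> 'a set \<Rightarrow> 'a set" (infixr \<open>\<star>\<close> 80) where
  "c \<star> A = (\<lambda>x. c \<otimes> x) ` A"

lemma ideal_mult_ideal [intro]: "c \<in> carrier R \<Longrightarrow> ideal A R \<Longrightarrow> ideal (c \<star> A) R"
  unfolding mult_ideal_def
proof (rule ideal_cringI)
  assume c: "c \<in> carrier R" and A: "ideal A R"
  then show "(\<otimes>) c ` A \<subseteq> carrier R" by (auto intro: ideal.Icarr)
  show "\<zero> \<in> (\<otimes>) c ` A" using c ideal_zero[OF A] by force
  show "x \<oplus> y \<in> (\<otimes>) c ` A" if xy: "x \<in> (\<otimes>) c ` A" "y \<in> (\<otimes>) c ` A" for x y
  proof -
    obtain u v where "u \<in> A" "v \<in> A" "x = c \<otimes> u" "y = c \<otimes> v" using xy by blast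
    moreover then have "x \<oplus> y = c \<otimes> (u \<oplus> v)" using c ideal.Icarr[OF A] by (auto simp: r_distr)
    ultimately show ?thesis using ideal_add[OF A] by blast
  qed
  show "r \<otimes> x \<in> (\<otimes>) c ` A" if rx: "r \<in> carrier R" "x \<in> (\<otimes>) c ` A" for r x
  proof -
    obtain u where u: "u \<in> A" "x = c \<otimes> u" using rx by blast
    then have "r \<otimes> x = c \<otimes> (r \<otimes> u)" using c rx(1) ideal.Icarr[OF A] by (auto simp: m_lcomm)
    then show ?thesis using u rx(1) ideal.I_l_closed[OF A] by blast
  qed
qed

lemma mult_ideal_le: "c \<in> carrier R \<Longrightarrow> ideal A R \<Longrightarrow> c \<star> A \<subseteq> A"
  unfolding mult_ideal_def using ideal.I_l_closed by fastforce

lemma mult_ideal_mono: "A \<subseteq> B \<Longrightarrow> c \<star> A \<subseteq> c \<star> B"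
  unfolding mult_ideal_def by blast

lemma cgenideal_prod_eq:
  assumes c: "c \<in> carrier R" and A: "ideal A R"
  shows "(PIdl c) \<cdot> A = c \<star> A"
proof
  show "(PIdl c) \<cdot> A \<subseteq> c \<star> A"
  proof (rule ideal_prod_least)
    show "x \<otimes> y \<in> c \<star> A" if x: "x \<in> PIdl c" and y: "y \<in> A" for x y
    proof -
      obtain r where r: "r \<in> carrier R" "x = r \<otimes> c" using x unfolding cgenideal_def by blast
      then have "x \<otimes> y = c \<otimes> (r \<otimes> y)"
        using c y ideal.Icarr[OF A] by (auto simp: m_assoc m_lcomm)
      then show ?thesis using r y ideal.I_l_closed[OF A] unfolding mult_ideal_def by blast
    qed
  qed (use assms in auto)
  show "c \<star> A \<subseteq> (PIdl c) \<cdot> A"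
    unfolding mult_ideal_def using cgenideal_self[OF c] by (auto intro: ideal_prod.prod)
qed

lemma cgenideal_eq_mult: "c \<in> carrier R \<Longrightarrow> PIdl c = c \<star> carrier R"
  unfolding cgenideal_def mult_ideal_def using m_comm by auto

lemma mult_ideal_prod:
  assumes "c \<in> carrier R" "ideal A R" "ideal B R"
  shows "(c \<star> A) \<cdot> B = c \<star> (A \<cdot> B)"
  using assms cgenideal_prod_eq[of c] ideal_prod_assoc[OF cgenideal_ideal, of c A B] ideal_prod_is_ideal
  by simp


subsection \<open>Nonzerodivisors\<close>

definition regular :: "'a \<Rightarrow> bool" where
  "regular c \<longleftrightarrow> c \<in> carrier R \<and> (\<forall>x\<in>carrier R. c \<otimes> x = \<zero> \<longrightarrow> x = \<zero>)"

lemma regular_carrier [simp]: "regular c \<Longrightarrow> c \<in> carrier R"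
  by (simp add: regular_def)

lemma regularI:
  "c \<in> carrier R \<Longrightarrow> (\<And>x. x \<in> carrier R \<Longrightarrow> c \<otimes> x = \<zero> \<Longrightarrow> x = \<zero>) \<Longrightarrow> regular c"
  unfolding regular_def by blast

lemma regularD: "regular c \<Longrightarrow> x \<in> carrier R \<Longrightarrow> c \<otimes> x = \<zero> \<Longrightarrow> x = \<zero>"
  unfolding regular_def by blast

lemma regular_cancel:
  assumes "regular c" "x \<in> carrier R" "y \<in> carrier R" "c \<otimes> x = c \<otimes> y"
  shows "x = y"
proof -
  have "c \<otimes> (x \<ominus> y) = \<zero>"
    using assms by (simp add: a_minus_def r_distr r_minus r_neg)
  then have "x \<ominus> y = \<zero>" 
    using regularD[OF assms(1) minus_closed[OF assms(2,3)]] by simp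
  then show ?thesis using assms(2,3) by simp
qed

lemma regular_mult:
  assumes "regular c" "regular d"
  shows "regular (c \<otimes> d)"
proof (rule regularI)
  fix x assume x: "x \<in> carrier R" "c \<otimes> d \<otimes> x = \<zero>"
  then have "c \<otimes> (d \<otimes> x) = \<zero>" using assms by (simp add: m_assoc)
  then have "d \<otimes> x = \<zero>" using regularD[OF assms(1)] x(1) assms(2) by simp
  then show "x = \<zero>" using regularD[OF assms(2) x(1)] by simp
qed (use assms in simp)

lemma regular_factor:
  assumes "c \<in> carrier R" "d \<in> carrier R" "regular (c \<otimes> d)"
  shows "regular c"
proof (rule regularI)
  fix x assume x: "x \<in> carrier R" "c \<otimes> x = \<zero>"
  then have "(c \<otimes> d) \<otimes> x = d \<otimes> (c \<otimes> x)"
    using assms(1,2) by (metis m_comm m_assoc)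
  then have "(c \<otimes> d) \<otimes> x = \<zero>" using x(2) assms(2) by simp
  then show "x = \<zero>" using regularD[OF assms(3) x(1)] by simp
qed (rule assms)

lemma regular_pow: "regular c \<Longrightarrow> regular (c [^] (n::nat))"
proof (induction n)
  case 0
  show ?case by (rule regularI) auto
qed (simp add: regular_mult)

text \<open>Multiplication by a nonzerodivisor is an isomorphism of \<open>B\<close> onto
  \<open>c \<star> B\<close> taking \<open>A\<close> to \<open>c \<star> A\<close>; chains are
  transported by image and preimage.\<close>

lemma len_mult_ideal:
  assumes c: "regular c" and A: "ideal A R" "ideal B R" "A \<subseteq> B"
  shows "len (c \<star> A) (c \<star> B) = len A B"
  unfolding len_def
proof (rule antisym)
  show "chain_length (ideal_interval A B) \<le> chain_length (ideal_interval (c \<star> A) (c \<star> B))"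
  proof (rule chain_length_mono_map[where f = "\<lambda>N. c \<star> N"])
    fix N N' assume N: "N \<in> ideal_interval A B" "N' \<in> ideal_interval A B" "N \<subset> N'"
    then obtain x where x: "x \<in> N'" "x \<notin> N" by blast
    have sub: "N \<subseteq> carrier R" "N' \<subseteq> carrier R" using N by (auto simp: ideal_interval_def intro: ideal.Icarr)
    have "c \<otimes> x \<notin> c \<star> N"
      using regular_cancel[OF c, of x] x sub by (auto simp: mult_ideal_def)
    then show "c \<star> N \<subset> c \<star> N'" using N(3) x unfolding mult_ideal_def by blast
  qed (use c in \<open>auto simp: ideal_interval_def mult_ideal_def[of c]
      intro!: ideal_mult_ideal[unfolded mult_ideal_def]\<close>)
  show "chain_length (ideal_interval (c \<star> A) (c \<star> B)) \<le> chain_length (ideal_interval A B)"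
  proof (rule chain_length_mono_map[where f = "\<lambda>N. {x \<in> B. c \<otimes> x \<in> N}"])
    fix N assume "N \<in> ideal_interval (c \<star> A) (c \<star> B)"
    then have N: "ideal N R" "c \<star> A \<subseteq> N" "N \<subseteq> c \<star> B" by (auto simp: ideal_interval_def)
    have car: "x \<in> carrier R" if "x \<in> B" for x using ideal.Icarr[OF A(2) that] .
    have "ideal {x \<in> B. c \<otimes> x \<in> N} R"
      by (rule ideal_cringI)
        (use c car ideal_zero[OF A(2)] ideal_zero[OF N(1)] ideal_add[OF A(2)] ideal_add[OF N(1)]
          ideal.I_l_closed[OF A(2)] ideal.I_l_closed[OF N(1)] in
          \<open>auto simp: r_distr m_lcomm[of c]\<close>)
    then show "{x \<in> B. c \<otimes> x \<in> N} \<in> ideal_interval A B"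
      using N A(3) by (auto simp: ideal_interval_def mult_ideal_def)
  next
    fix N N' assume N: "N \<in> ideal_interval (c \<star> A) (c \<star> B)"
      "N' \<in> ideal_interval (c \<star> A) (c \<star> B)" "N \<subset> N'"
    then obtain x where "x \<in> N'" "x \<notin> N" "N' \<subseteq> c \<star> B" by (auto simp: ideal_interval_def)
    then show "{x \<in> B. c \<otimes> x \<in> N} \<subset> {x \<in> B. c \<otimes> x \<in> N'}"
      using N(3) by (auto simp: mult_ideal_def)
  qed
qed

text \<open>The length of \<open>R/cA\<close> is computed through \<open>A\<close> and through
  \<open>cR\<close>. Since \<open>cR/cA\<close> is isomorphic to \<open>R/A\<close>, this common
  finite term cancels.\<close>

lemma len_quot_mult_ideal:
  assumes c: "regular c" and A: "ideal A R" and fin: "len A (carrier R) \<noteq> \<infinity>"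
  shows "len (c \<star> A) A = len (c \<star> carrier R) (carrier R)"
proof -
  note ids = oneideal A ideal_mult_ideal[OF regular_carrier[OF c] A]
    ideal_mult_ideal[OF regular_carrier[OF c] oneideal]
  have "len (c \<star> A) A + len A (carrier R) = len (c \<star> A) (carrier R)"
    using ids mult_ideal_le[OF regular_carrier[OF c] A] ideal_subset[OF A]
    by (intro len_add[symmetric]) auto
  also have "\<dots> = len (c \<star> A) (c \<star> carrier R) + len (c \<star> carrier R) (carrier R)"
    using ids ideal_subset[OF A] ideal_subset[OF ids(4)] by (intro len_add mult_ideal_mono)
  also have "len (c \<star> A) (c \<star> carrier R) = len A (carrier R)"
    using len_mult_ideal[OF c A oneideal] ideal_subset[OF A] by simp
  finally show ?thesis using fin
    by (cases "len (c \<star> A) A"; cases "len A (carrier R)"; cases "len (c \<star> carrier R) (carrier R)") auto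
qed

end


section \<open>Noetherian local rings\<close>

text \<open>In a Noetherian ring a nonempty chain of ideals contains its own union, so Zorn's lemma
  applies to any nonempty family of ideals. This is the form of Noetherian induction used
  below.\<close>

lemma (in noetherian_ring) exists_maximal_ideal:
  assumes "S \<noteq> {}" "\<And>J. J \<in> S \<Longrightarrow> ideal J R"
  shows "\<exists>M\<in>S. \<forall>X\<in>S. M \<subseteq> X \<longrightarrow> X = M"
proof (rule subset_Zorn_nonempty[OF assms(1)])
  fix C assume C: "C \<noteq> {}" "subset.chain S C"
  have sub: "C \<subseteq> S" using C(2) by (simp add: pred_on.chain_def)
  moreover have "S \<subseteq> {I. ideal I R}" using assms(2) by (auto simp only: mem_Collect_eq subset_iff)
  ultimately have "subset.chain {I. ideal I R} C"
    using C(2) by (simp add: pred_on.chain_def)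
  from ideal_chain_is_trivial[OF C(1) this] show "\<Union>C \<in> S"
    by (rule subsetD[OF sub])
qed

context noetherian_local_ring
begin

sublocale m: maximalideal m R by (rule maximal)

lemma ideal_m [intro]: "ideal m R"
  by (rule m.ideal_axioms)

lemma one_notin_m: "\<one> \<notin> m"
  using m.one_imp_carrier m.I_notcarr by auto

text \<open>An ideal that is maximal among the proper ideals above \<open>J\<close> is a maximal
  ideal, and \<open>m\<close> is the only one.\<close>

lemma proper_ideal_le_m:
  assumes J: "ideal J R" "J \<noteq> carrier R"
  shows "J \<subseteq> m"
proof -
  let ?S = "{K. ideal K R \<and> J \<subseteq> K \<and> K \<noteq> carrier R}"
  obtain M where M: "M \<in> ?S" "\<forall>X\<in>?S. M \<subseteq> X \<longrightarrow> X = M"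
    using exists_maximal_ideal[of ?S] J by blast
  have "maximalideal M R"
  proof (rule maximalidealI)
    show "K = M \<or> K = carrier R" if "ideal K R" "M \<subseteq> K" for K
      using M that by blast
  qed (use M in auto)
  then show ?thesis using unique_maximal M(1) by auto
qed

lemma unit_if_notin_m:
  assumes x: "x \<in> carrier R" "x \<notin> m"
  obtains u where "u \<in> carrier R" "u \<otimes> x = \<one>"
proof -
  have "PIdl x = carrier R"
    using proper_ideal_le_m[OF cgenideal_ideal[OF x(1)]] cgenideal_self[OF x(1)] x(2) by blast
  then have "\<one> \<in> PIdl x" by simp
  then show ?thesis using that unfolding cgenideal_def by auto
qed

lemma mem_if_unit_mult_mem:
  assumes K: "ideal K R" and x: "x \<in> carrier R" "x \<notin> m" and c: "c \<in> carrier R" "x \<otimes> c \<in> K"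
  shows "c \<in> K"
proof -
  obtain u where u: "u \<in> carrier R" "u \<otimes> x = \<one>" using unit_if_notin_m[OF x] by blast
  have "u \<otimes> (x \<otimes> c) \<in> K" using ideal.I_l_closed[OF K c(2) u(1)] .
  moreover have "u \<otimes> (x \<otimes> c) = c" using u x c by (simp flip: m_assoc)
  ultimately show ?thesis by simp
qed

text \<open>An associated prime of \<open>N\<close> (after inverting \<open>S\<close>): choose \<open>c\<close> with maximal annihilator.\<close>

lemma exists_prime_colon:
  assumes N: "ideal N R" and S: "S \<subseteq> carrier R" "\<one> \<in> S"
    and S_mult: "\<And>s t. s \<in> S \<Longrightarrow> t \<in> S \<Longrightarrow> s \<otimes> t \<in> S" and disj: "S \<inter> N = {}"
  shows "\<exists>c\<in>carrier R. (\<forall>s\<in>S. s \<otimes> c \<notin> N) \<and>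
    primeideal {r \<in> carrier R. \<exists>s\<in>S. s \<otimes> r \<otimes> c \<in> N} R"
proof -
  \<comment> \<open>\<open>Q c\<close> is the annihilator of the image of \<open>c\<close> in the
    localization of \<open>R/N\<close> at \<open>S\<close>, pulled back to \<open>R\<close>;
    \<open>G\<close> collects the \<open>c\<close> with nonzero image.\<close>
  define Q where "Q c = {r \<in> carrier R. \<exists>s\<in>S. s \<otimes> r \<otimes> c \<in> N}" for c
  define G where "G = {c \<in> carrier R. \<forall>s\<in>S. s \<otimes> c \<notin> N}"
  have Sc: "s \<in> carrier R" if "s \<in> S" for s using that S by blast
  have idQ: "ideal (Q c) R" if c: "c \<in> carrier R" for c
  proof (rule ideal_cringI)
    show "Q c \<subseteq> carrier R" by (auto simp: Q_def)
    have "\<one> \<otimes> \<zero> \<otimes> c \<in> N" using c ideal_zero[OF N] by simp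
    then show "\<zero> \<in> Q c" using S(2) unfolding Q_def by blast
    show "x \<oplus> y \<in> Q c" if xQ: "x \<in> Q c" and yQ: "y \<in> Q c" for x y
    proof -
      obtain s t where st: "s \<in> S" "t \<in> S" "s \<otimes> x \<otimes> c \<in> N" "t \<otimes> y \<otimes> c \<in> N"
        and xy: "x \<in> carrier R" "y \<in> carrier R" using xQ yQ unfolding Q_def by blast
      have car: "s \<in> carrier R" "t \<in> carrier R" using Sc st by auto
      have "t \<otimes> (s \<otimes> x \<otimes> c) \<oplus> s \<otimes> (t \<otimes> y \<otimes> c) \<in> N"
        using ideal_add[OF N] ideal.I_l_closed[OF N] st car by blast
      moreover have "t \<otimes> (s \<otimes> x \<otimes> c) \<oplus> s \<otimes> (t \<otimes> y \<otimes> c) = (s \<otimes> t) \<otimes> (x \<oplus> y) \<otimes> c"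
        using car xy c by (simp add: r_distr l_distr m_ac)
      ultimately show ?thesis using S_mult[OF st(1,2)] xy by (auto simp: Q_def)
    qed
    show "r \<otimes> x \<in> Q c" if r: "r \<in> carrier R" and x: "x \<in> Q c" for r x
    proof -
      obtain s where s: "s \<in> S" "s \<otimes> x \<otimes> c \<in> N" "x \<in> carrier R" using x unfolding Q_def by blast
      have "r \<otimes> (s \<otimes> x \<otimes> c) \<in> N" using ideal.I_l_closed[OF N s(2) r] .
      moreover have "r \<otimes> (s \<otimes> x \<otimes> c) = s \<otimes> (r \<otimes> x) \<otimes> c"
        using Sc[OF s(1)] s(3) r c by (simp add: m_ac)
      ultimately show ?thesis using s r by (auto simp: Q_def)
    qed
  qed
  have "\<one> \<in> G" using disj Sc by (auto simp: G_def)
  then have "Q ` G \<noteq> {}" by blast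
  moreover have "ideal J R" if "J \<in> Q ` G" for J using that idQ by (auto simp: G_def)
  ultimately obtain M where M: "M \<in> Q ` G" "\<forall>X\<in>Q ` G. M \<subseteq> X \<longrightarrow> X = M"
    using exists_maximal_ideal[of "Q ` G"] by meson
  then obtain c where c: "c \<in> G" "M = Q c" by blast
  have cc: "c \<in> carrier R" and cN: "\<And>s. s \<in> S \<Longrightarrow> s \<otimes> c \<notin> N" using c by (auto simp: G_def)
  have "primeideal (Q c) R"
  proof (rule primeidealI)
    show "ideal (Q c) R" by (rule idQ[OF cc])
    show "cring R" by (rule is_cring)
    have "\<one> \<notin> Q c" using cN Sc cc by (auto simp: Q_def)
    then show "carrier R \<noteq> Q c" by auto
    fix a b assume ab: "a \<in> carrier R" "b \<in> carrier R" "a \<otimes> b \<in> Q c"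
    show "a \<in> Q c \<or> b \<in> Q c"
    proof (rule disjCI)
      assume nb: "b \<notin> Q c"
      have bc: "s \<otimes> (b \<otimes> c) = s \<otimes> b \<otimes> c" if "s \<in> S" for s
        using Sc[OF that] ab cc by (simp add: m_assoc)
      then have "b \<otimes> c \<in> G" using nb ab cc by (auto simp: G_def Q_def)
      \<comment> \<open>The annihilator can only grow from \<open>c\<close> to
        \<open>b \<otimes> c\<close>, so by maximality it stays the same; then \<open>a\<close>,
        which kills \<open>b \<otimes> c\<close> in the localization, also kills
        \<open>c\<close>.\<close>
      moreover have "Q c \<subseteq> Q (b \<otimes> c)"
      proof
        fix r assume "r \<in> Q c"
        then obtain s where s: "s \<in> S" "s \<otimes> r \<otimes> c \<in> N" "r \<in> carrier R" unfolding Q_def by blast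
        have "b \<otimes> (s \<otimes> r \<otimes> c) \<in> N" using ideal.I_l_closed[OF N s(2) ab(2)] .
        moreover have "b \<otimes> (s \<otimes> r \<otimes> c) = s \<otimes> r \<otimes> (b \<otimes> c)"
          using Sc[OF s(1)] s(3) ab cc by (simp add: m_ac)
        ultimately show "r \<in> Q (b \<otimes> c)" using s by (auto simp: Q_def)
      qed
      ultimately have eq: "Q (b \<otimes> c) = Q c" using M(2) c(2) by blast
      obtain s where s: "s \<in> S" "s \<otimes> (a \<otimes> b) \<otimes> c \<in> N" using ab(3) unfolding Q_def by blast
      have "s \<otimes> (a \<otimes> b) \<otimes> c = s \<otimes> a \<otimes> (b \<otimes> c)"
        using Sc[OF s(1)] ab cc by (simp add: m_assoc)
      then have "a \<in> Q (b \<otimes> c)" using s ab(1) unfolding Q_def by auto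
      then show "a \<in> Q c" using eq by simp
    qed
  qed
  then show ?thesis using cc cN unfolding Q_def by blast
qed

text \<open>Take \<open>K\<close> maximal among the ideals that contain \<open>X\<close> and lie
  strictly inside \<open>Y\<close>. For any \<open>c\<close> in \<open>Y\<close> outside
  \<open>K\<close>, the ideal \<open>Y\<close> equals both \<open>K + aY\<close> and
  \<open>K + (c)\<close>, so \<open>(1 - ar)c\<close> lies in \<open>K\<close> for some
  \<open>r\<close>. As \<open>1 - ar\<close> is a unit, \<open>c\<close> lies in \<open>K\<close>, a
  contradiction.\<close>

lemma nakayama:
  assumes X: "ideal X R" and Y: "ideal Y R" and sub: "X \<subseteq> Y" and a: "a \<in> m"
    and le: "Y \<subseteq> X <+> a \<star> Y"
  shows "X = Y"
proof (rule ccontr)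
  assume neq: "X \<noteq> Y"
  have ac: "a \<in> carrier R" using a m.Icarr by blast
  let ?S = "{K. ideal K R \<and> X \<subseteq> K \<and> K \<subset> Y}"
  obtain K where K: "K \<in> ?S" "\<forall>L\<in>?S. K \<subseteq> L \<longrightarrow> L = K"
    using exists_maximal_ideal[of ?S] X sub neq by blast
  then have K': "ideal K R" "X \<subseteq> K" "K \<subset> Y" by auto
  have max: "L = Y" if "ideal L R" "K \<subset> L" "L \<subseteq> Y" for L
    using K that by blast
  have idaY: "ideal (a \<star> Y) R" using ac Y by auto
  have KaY: "K <+> a \<star> Y = Y"
  proof (rule max)
    show "ideal (K <+> a \<star> Y) R" by (rule add_ideals[OF K'(1) idaY])
    show "K <+> a \<star> Y \<subseteq> Y"
      by (rule ideal_sum_least[OF Y]) (use K' mult_ideal_le[OF ac Y] in auto)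
    have "Y \<subseteq> K <+> a \<star> Y" using le set_add_mono[OF K'(2), of "a \<star> Y"] by (rule order.trans)
    then show "K \<subset> K <+> a \<star> Y" using K'(3) by blast
  qed
  obtain c where c: "c \<in> Y" "c \<notin> K" using K' by blast
  have cc: "c \<in> carrier R" using ideal.Icarr[OF Y c(1)] .
  have idc: "ideal (PIdl c) R" using cgenideal_ideal[OF cc] .
  have Kc: "K <+> PIdl c = Y"
  proof (rule max)
    show "ideal (K <+> PIdl c) R" by (rule add_ideals[OF K'(1) idc])
    show "K <+> PIdl c \<subseteq> Y"
      by (rule ideal_sum_least[OF Y]) (use K' cgenideal_minimal[OF Y c(1)] in auto)
    show "K \<subset> K <+> PIdl c"
      using ideal_sum_left[OF K'(1) idc] ideal_sum_right[OF K'(1) idc] cgenideal_self[OF cc] c by blast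
  qed
  have "c \<in> K <+> a \<star> Y" using c(1) KaY by simp
  then obtain k y where ky: "k \<in> K" "y \<in> Y" "c = k \<oplus> a \<otimes> y"
    by (auto simp: mem_set_add_iff mult_ideal_def)
  have "y \<in> K <+> PIdl c" using ky(2) Kc by simp
  then obtain k' r where kr: "k' \<in> K" "r \<in> carrier R" "y = k' \<oplus> r \<otimes> c"
    by (auto simp: mem_set_add_iff cgenideal_def)
  have car: "k \<in> carrier R" "k' \<in> carrier R"
    using ideal.Icarr[OF K'(1)] ky(1) kr(1) by auto
  have "c = k \<oplus> a \<otimes> (k' \<oplus> r \<otimes> c)" using ky(3) unfolding kr(3) .
  also have "\<dots> = k \<oplus> a \<otimes> k' \<oplus> a \<otimes> r \<otimes> c"
    using ac kr(2) cc car by (simp add: r_distr m_assoc a_assoc)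
  finally have c_eq: "c = k \<oplus> a \<otimes> k' \<oplus> a \<otimes> r \<otimes> c" .
  have "(\<one> \<ominus> a \<otimes> r) \<otimes> c = c \<ominus> a \<otimes> r \<otimes> c"
    using ac kr(2) cc by (simp add: a_minus_def l_distr l_minus)
  also have "\<dots> = (k \<oplus> a \<otimes> k' \<oplus> a \<otimes> r \<otimes> c) \<ominus> a \<otimes> r \<otimes> c"
    using arg_cong[OF c_eq, of "\<lambda>x. x \<ominus> a \<otimes> r \<otimes> c"] .
  also have "\<dots> = k \<oplus> a \<otimes> k'"
    using ac kr(2) cc car by (simp add: a_minus_def a_assoc r_neg)
  also have "\<dots> \<in> K" using ideal_add[OF K'(1)] ideal.I_l_closed[OF K'(1)] ky(1) kr(1) ac by auto
  finally have "(\<one> \<ominus> a \<otimes> r) \<otimes> c \<in> K" .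
  moreover have "\<one> \<ominus> a \<otimes> r \<notin> m"
  proof
    assume "\<one> \<ominus> a \<otimes> r \<in> m"
    then have "(\<one> \<ominus> a \<otimes> r) \<oplus> a \<otimes> r \<in> m"
      using a kr(2) m.I_r_closed by auto
    moreover have "(\<one> \<ominus> a \<otimes> r) \<oplus> a \<otimes> r = \<one>"
      using ac kr(2) by (simp add: a_minus_def a_assoc l_neg)
    ultimately show False using one_notin_m by simp
  qed
  ultimately have "c \<in> K"
    using mem_if_unit_mult_mem[OF K'(1), of "\<one> \<ominus> a \<otimes> r" c] ac kr(2) cc by auto
  then show False using c by simp
qed

text \<open>The infinite residue field takes the place of primality in prime avoidance. If
  \<open>x\<close> avoids the old ideals but lies in the new \<open>V\<close>, and \<open>z\<close>
  avoids \<open>V\<close>, then every \<open>z + tx\<close> avoids \<open>V\<close>, and each old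
  ideal contains \<open>z + tx\<close> for at most one residue class of \<open>t\<close>.\<close>

lemma ideal_avoidance:
  assumes inf: "infinite (carrier (R Quot m))" and J: "ideal J R"
    and "finite \<V>" "\<And>V. V \<in> \<V> \<Longrightarrow> ideal V R \<and> \<not> J \<subseteq> V"
  shows "\<exists>y\<in>J. y \<notin> \<Union>\<V>"
  using assms(3,4)
proof (induction \<V>)
  case empty
  then show ?case using ideal_zero[OF J] by blast
next
  case (insert V \<V>)
  then obtain x where x: "x \<in> J" "x \<notin> \<Union>\<V>" by blast
  show ?case
  proof (cases "x \<in> V")
    case False
    then show ?thesis using x by blast
  next
    case True
    obtain z where z: "z \<in> J" "z \<notin> V" using insert.prems by blast
    have V: "ideal V R" using insert.prems by blast
    have car: "x \<in> carrier R" "z \<in> carrier R" using x z ideal.Icarr[OF J] by auto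
    \<comment> \<open>One representative per residue class, so that differences of distinct
      representatives are units.\<close>
    define rep where "rep X = (SOME t. t \<in> carrier R \<and> X = m +> t)" for X
    have rep: "rep X \<in> carrier R" "X = m +> rep X" if "X \<in> carrier (R Quot m)" for X
    proof -
      have "\<exists>t. t \<in> carrier R \<and> X = m +> t"
        using that by (auto simp: FactRing_def A_RCOSETS_def')
      then show "rep X \<in> carrier R" "X = m +> rep X" unfolding rep_def by (metis (mono_tags, lifting) someI_ex)+
    qed
    have notV: "z \<oplus> t \<otimes> x \<notin> V" if t: "t \<in> carrier R" for t
    proof
      assume "z \<oplus> t \<otimes> x \<in> V"
      then have "(z \<oplus> t \<otimes> x) \<ominus> t \<otimes> x \<in> V"
        using ideal_minus[OF V] ideal.I_l_closed[OF V True t] by blast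
      moreover have "(z \<oplus> t \<otimes> x) \<ominus> t \<otimes> x = z"
        using car t by (simp add: a_minus_def a_assoc r_neg)
      ultimately show False using z by simp
    qed
    have "\<exists>X\<in>carrier (R Quot m). z \<oplus> rep X \<otimes> x \<notin> \<Union>\<V>"
    proof (rule ccontr)
      assume "\<not> ?thesis"
      then have "\<forall>X\<in>carrier (R Quot m). \<exists>W. W \<in> \<V> \<and> z \<oplus> rep X \<otimes> x \<in> W" by blast
      then obtain f where f: "\<forall>X\<in>carrier (R Quot m). f X \<in> \<V> \<and> z \<oplus> rep X \<otimes> x \<in> f X"
        using bchoice[of "carrier (R Quot m)"] by meson
      have "finite (f ` carrier (R Quot m))"
        using finite_subset[OF _ insert.hyps(1)] f by blast
      then obtain X where X: "X \<in> carrier (R Quot m)"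
        "infinite {Y \<in> carrier (R Quot m). f Y = f X}"
        using pigeonhole_infinite[OF inf] by blast
      have "\<not> {Y \<in> carrier (R Quot m). f Y = f X} \<subseteq> {X}"
        using X(2) finite_subset by blast
      then obtain Y where Y: "Y \<in> carrier (R Quot m)" "f Y = f X" "Y \<noteq> X" by blast
      have W: "ideal (f X) R" using f X(1) insert.prems by blast
      have r: "rep X \<in> carrier R" "rep Y \<in> carrier R" using rep X(1) Y(1) by auto
      have "rep X \<ominus> rep Y \<notin> m"
        using quotient_eq_iff_same_a_r_cos[OF ideal_m r] rep(2)[OF X(1)] rep(2)[OF Y(1)] Y(3) by simp
      moreover have "(z \<oplus> rep X \<otimes> x) \<ominus> (z \<oplus> rep Y \<otimes> x) \<in> f X"
      proof (rule ideal_minus[OF W])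
        show "z \<oplus> rep X \<otimes> x \<in> f X" using f X(1) by blast
        show "z \<oplus> rep Y \<otimes> x \<in> f X" using f Y(1) unfolding Y(2)[symmetric] by blast
      qed
      moreover have "(z \<oplus> rep X \<otimes> x) \<ominus> (z \<oplus> rep Y \<otimes> x) = (rep X \<ominus> rep Y) \<otimes> x"
      proof -
        have "(z \<oplus> rep X \<otimes> x) \<ominus> (z \<oplus> rep Y \<otimes> x)
            = (rep X \<otimes> x \<oplus> z) \<oplus> (\<ominus> z \<oplus> \<ominus> (rep Y \<otimes> x))"
          using car r by (simp add: a_minus_def minus_add a_comm)
        also have "\<dots> = rep X \<otimes> x \<oplus> \<ominus> (rep Y \<otimes> x)"
          using car r by (simp add: a_assoc r_neg1 r_neg2)
        finally show ?thesis using car r by (simp add: a_minus_def l_distr l_minus)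
      qed
      ultimately have "x \<in> f X"
        using mem_if_unit_mult_mem[OF W _ _ car(1), of "rep X \<ominus> rep Y"] r by auto
      then show False using f X(1) x(2) by blast
    qed
    then obtain X where X: "X \<in> carrier (R Quot m)" "z \<oplus> rep X \<otimes> x \<notin> \<Union>\<V>" by blast
    have "z \<oplus> rep X \<otimes> x \<in> J"
      using ideal_add[OF J z(1)] ideal.I_l_closed[OF J x(1)] rep(1)[OF X(1)] by blast
    then show ?thesis using X(2) notV[OF rep(1)[OF X(1)]] by blast
  qed
qed

text \<open>As \<open>m\<close> kills \<open>c\<close> modulo \<open>N\<close>, the quotient of
  \<open>N + (c)\<close> by \<open>N\<close> is a copy of the residue field, and no ideal lies
  strictly in between.\<close>

lemma len_simple_extension:
  assumes N: "ideal N R" and c: "c \<in> carrier R" "c \<notin> N" and mc: "\<And>r. r \<in> m \<Longrightarrow> r \<otimes> c \<in> N"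
  shows "N \<subset> N <+> PIdl c" "len N (N <+> PIdl c) \<noteq> \<infinity>"
proof -
  let ?N = "N <+> PIdl c"
  have idc: "ideal (PIdl c) R" using cgenideal_ideal[OF c(1)] .
  have idN: "ideal ?N R" by (rule add_ideals[OF N idc])
  show N_sub: "N \<subset> ?N"
    using ideal_sum_left[OF N idc] ideal_sum_right[OF N idc] cgenideal_self[OF c(1)] c(2) by blast
  have two: "K = N \<or> K = ?N" if "K \<in> ideal_interval N ?N" for K
  proof (rule disjCI)
    assume "K \<noteq> ?N"
    have K: "ideal K R" "N \<subseteq> K" "K \<subseteq> ?N" using that by (auto simp: ideal_interval_def)
    show "K = N"
    proof (rule ccontr)
      assume "K \<noteq> N"
      then obtain k where k: "k \<in> K" "k \<notin> N" using K by blast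
      then obtain n r where nr: "n \<in> N" "r \<in> carrier R" "k = n \<oplus> r \<otimes> c"
        using K(3) by (fastforce simp: mem_set_add_iff cgenideal_def)
      have "r \<notin> m" using k(2) nr mc[of r] ideal_add[OF N, of n "r \<otimes> c"] by auto
      moreover have "k \<ominus> n \<in> K" using ideal_minus[OF K(1) k(1)] nr(1) K(2) by blast
      moreover have "k \<ominus> n = r \<otimes> c"
      proof -
        have "n \<in> carrier R" using ideal.Icarr[OF N nr(1)] .
        then show ?thesis using nr c by (simp add: a_minus_def a_comm a_assoc[symmetric] r_neg a_ac)
      qed
      ultimately have "c \<in> K" using mem_if_unit_mult_mem[OF K(1) nr(2) _ c(1)] by simp
      then have "?N \<subseteq> K"
        by (intro ideal_sum_least[OF K(1) K(2)] cgenideal_minimal[OF K(1)])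
      then show False using K(3) \<open>K \<noteq> ?N\<close> by blast
    qed
  qed
  have "\<not> enat 2 \<le> len N ?N"
  proof
    assume "enat 2 \<le> len N ?N"
    then obtain F where F: "\<forall>i\<le>2. F i \<in> ideal_interval N ?N" "\<forall>i<2. F i \<subset> F (Suc i)"
      unfolding enat_le_len_iff[OF N psubset_imp_subset[OF N_sub]] chain_of_length_def by blast
    then have "F 0 \<in> ideal_interval N ?N" "F 1 \<in> ideal_interval N ?N" "F 2 \<in> ideal_interval N ?N"
      by auto
    moreover have "F 0 \<subset> F 1" using F(2)[rule_format, of 0] by simp
    moreover have "F 1 \<subset> F 2" using F(2)[rule_format, of 1] by (simp add: numeral_2_eq_2)
    ultimately show False using two by blast
  qed
  then show "len N ?N \<noteq> \<infinity>" by (metis enat_ord_code(3))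
qed

end

section \<open>Dimension one: ideals containing a nonzerodivisor have finite colength\<close>

locale one_dimensional_local_ring = noetherian_local_ring +
  assumes dim_1: "krull_dim R = 1"
begin

text \<open>Otherwise, an associated prime of zero in the localization at \<open>P\<close> pulls
  back to a prime inside \<open>P\<close>. Its elements kill a nonzero element of the localization,
  so it misses \<open>a\<close>. Together with \<open>P\<close> and \<open>m\<close> it forms a
  chain of length 2.\<close>

lemma prime_containing_regular:
  assumes P: "primeideal P R" and a: "regular a" "a \<in> P"
  shows "P = m"
proof (rule ccontr)
  assume "P \<noteq> m"
  interpret P: primeideal P R by (rule P)
  have "P \<subseteq> m" using proper_ideal_le_m[OF P.is_ideal] P.I_notcarr by blast
  with \<open>P \<noteq> m\<close> have Pm: "P \<subset> m" by blast
  have one: "\<one> \<in> carrier R - P" using P.one_imp_carrier P.I_notcarr by auto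
  have mult: "s \<otimes> t \<in> carrier R - P" if "s \<in> carrier R - P" "t \<in> carrier R - P" for s t
    using that P.I_prime by auto
  have disj: "(carrier R - P) \<inter> {\<zero>} = {}" by auto
  obtain c where c: "c \<in> carrier R" "\<forall>s\<in>carrier R - P. s \<otimes> c \<notin> {\<zero>}"
    and Q: "primeideal {r \<in> carrier R. \<exists>s\<in>carrier R - P. s \<otimes> r \<otimes> c \<in> {\<zero>}} R" (is "primeideal ?Q R")
    using exists_prime_colon[OF zeroideal Diff_subset one mult disj] by blast
  \<comment> \<open>For \<open>r\<close> outside \<open>P\<close> the product
    \<open>s \<otimes> r\<close> is again a multiplier outside \<open>P\<close>, and no such
    multiplier kills \<open>c\<close>.\<close>
  have "?Q \<subseteq> P"
  proof
    fix r assume "r \<in> ?Q"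
    then obtain s where s: "s \<in> carrier R - P" "r \<in> carrier R" "s \<otimes> r \<otimes> c = \<zero>" by blast
    then show "r \<in> P" using mult[of s r] c(2) by blast
  qed
  moreover have "a \<notin> ?Q"
  proof
    assume "a \<in> ?Q"
    then obtain s where s: "s \<in> carrier R - P" "s \<otimes> a \<otimes> c = \<zero>" by blast
    have "a \<otimes> (s \<otimes> c) = s \<otimes> a \<otimes> c" using a s(1) c(1) by (simp add: m_ac)
    then have "s \<otimes> c = \<zero>" using regularD[OF a(1)] s c(1) by simp
    then show False using c(2) s(1) by blast
  qed
  ultimately have QP: "?Q \<subset> P" using a(2) by blast
  define F :: "nat \<Rightarrow> 'a set" where "F = (\<lambda>i. if i = 0 then ?Q else if i = 1 then P else m)"
  have "(\<forall>i\<le>2. F i \<in> {P. primeideal P R}) \<and> (\<forall>i<2. F i \<subset> F (Suc i))"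
    using Q P maximalideal_prime[OF maximal] QP Pm by (auto simp: F_def less_2_cases_iff)
  then have "chain_of_length {P. primeideal P R} 2" unfolding chain_of_length_def by blast
  then have "enat 2 \<le> krull_dim R" unfolding krull_dim_eq by (rule chain_of_length_le)
  then show False using dim_1 by (simp add: one_enat_def)
qed

text \<open>Noetherian induction: let \<open>M\<close> be maximal with infinite colength. An
  associated prime of \<open>R/M\<close> contains \<open>a\<close>, hence equals \<open>m\<close>,
  so some \<open>M + (c)\<close> is strictly larger with finite length over \<open>M\<close>. Its
  own colength is finite by maximality, and additivity contradicts the choice of
  \<open>M\<close>.\<close>

lemma finite_colength:
  assumes a: "regular a" and N: "ideal N R" "a \<in> N"
  shows "len N (carrier R) \<noteq> \<infinity>"
proof
  assume inf: "len N (carrier R) = \<infinity>"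
  let ?S = "{N. ideal N R \<and> a \<in> N \<and> len N (carrier R) = \<infinity>}"
  have "\<exists>M\<in>?S. \<forall>X\<in>?S. M \<subseteq> X \<longrightarrow> X = M"
    by (rule exists_maximal_ideal) (use N inf in auto)
  then obtain M where M: "ideal M R" "a \<in> M" "len M (carrier R) = \<infinity>"
    and max: "\<And>X. ideal X R \<Longrightarrow> a \<in> X \<Longrightarrow> len X (carrier R) = \<infinity> \<Longrightarrow> M \<subseteq> X \<Longrightarrow> X = M" by auto
  have "M \<noteq> carrier R" using M(3) len_eq_0_iff[OF oneideal oneideal] by auto
  then have "\<one> \<notin> M" using ideal.one_imp_carrier[OF M(1)] by auto
  then have disj: "{\<one>} \<inter> M = {}" by blast
  \<comment> \<open>With \<open>\<one>\<close> as the only multiplier nothing is inverted, and the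
    prime obtained is an ordinary associated prime of \<open>R/M\<close>.\<close>
  have S: "{\<one>} \<subseteq> carrier R" "\<one> \<in> {\<one>}" by simp_all
  have mult: "s \<otimes> t \<in> {\<one>}" if "s \<in> {\<one>}" "t \<in> {\<one>}" for s t
    using that by simp
  obtain c where c: "c \<in> carrier R" "\<forall>s\<in>{\<one>}. s \<otimes> c \<notin> M"
    and Q: "primeideal {r \<in> carrier R. \<exists>s\<in>{\<one>}. s \<otimes> r \<otimes> c \<in> M} R" (is "primeideal ?Q R")
    using exists_prime_colon[OF M(1) S mult disj] by blast
  have "a \<in> ?Q" using a M(2) c(1) ideal.I_r_closed[OF M(1)] by simp
  with prime_containing_regular[OF Q a] have Qm: "?Q = m" .
  have mc: "r \<otimes> c \<in> M" if "r \<in> m" for r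
  proof -
    have "r \<in> ?Q" using that unfolding Qm .
    then have "\<one> \<otimes> r \<otimes> c \<in> M" "r \<in> carrier R" by blast+
    then show ?thesis by simp
  qed
  have cM: "c \<notin> M" using c by simp
  let ?M = "M <+> PIdl c"
  note ext = len_simple_extension[OF M(1) c(1) cM mc]
  have idM: "ideal ?M R" by (rule add_ideals[OF M(1) cgenideal_ideal[OF c(1)]])
  have "len ?M (carrier R) \<noteq> \<infinity>" using max[OF idM] ext(1) M(2) by blast
  moreover have "len M (carrier R) = len M ?M + len ?M (carrier R)"
    using len_add[OF M(1) _ idM _ oneideal] psubset_imp_subset[OF ext(1)] ideal_subset[OF idM] by simp
  ultimately show False using M(3) ext(2) by (metis plus_eq_infty_iff_enat)
qed

end


section \<open>The Eakin-Sathaye theorem\<close>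

context noetherian_local_ring
begin

text \<open>In the graded ring \<open>F = \<Oplus> I\<^sup>j/aI\<^sup>j\<close>: if \<open>c \<in> F\<^sub>k\<close> and \<open>\<ell>(cF\<^sub>n\<^sub>+\<^sub>1) \<le> n + 1\<close>, then some
  \<open>y \<in> I\<close> has \<open>cyF\<^sub>n = cF\<^sub>n\<^sub>+\<^sub>1\<close>. The induction needs \<open>y\<close> to be generic, that is, outside a given finite
  family \<open>\<V>\<close> of proper subideals. In the step, let \<open>y\<close> maximize \<open>\<ell>(cyF\<^sub>n\<^sub>+\<^sub>1)\<close>. If \<open>y\<close> fails, the
  induction hypothesis for \<open>cy\<close> gives generic \<open>z\<close> with \<open>cyF\<^sub>n\<^sub>+\<^sub>1 = cyzF\<^sub>n \<subseteq> czF\<^sub>n\<^sub>+\<^sub>1\<close>, with equality by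
  maximality; but the \<open>z\<close> with \<open>czF\<^sub>n\<^sub>+\<^sub>1 \<subseteq> cyF\<^sub>n\<^sub>+\<^sub>1\<close> form a proper subideal of \<open>I\<close>, which is added
  to \<open>\<V>\<close>.\<close>

lemma eakin_sathaye_aux:
  assumes inf: "infinite (carrier (R Quot m))" and I: "ideal I R" and a: "a \<in> carrier R"
    and "c \<in> ideal_power R I k" "finite \<V>" "\<And>V. V \<in> \<V> \<Longrightarrow> ideal V R \<and> \<not> I \<subseteq> V"
    and "len (a \<star> ideal_power R I (k + Suc n))
      (c \<star> ideal_power R I (Suc n) <+> a \<star> ideal_power R I (k + Suc n)) \<le> enat (Suc n)"
  shows "\<exists>y\<in>I. y \<notin> \<Union>\<V> \<and>
    (c \<otimes> y) \<star> ideal_power R I n <+> a \<star> ideal_power R I (k + Suc n) =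
    c \<star> ideal_power R I (Suc n) <+> a \<star> ideal_power R I (k + Suc n)"
  using assms(4-)
proof (induction n arbitrary: c k \<V>)
  case 0
  let ?M = "a \<star> ideal_power R I (k + Suc 0)"
  let ?A = "c \<star> I <+> ?M"
  have c: "c \<in> carrier R" using ideal.Icarr[OF ideal_ideal_power[OF I] "0.prems"(1)] .
  have M: "ideal ?M R" by (rule ideal_mult_ideal[OF a ideal_ideal_power[OF I]])
  have cI: "ideal (c \<star> I) R" by (rule ideal_mult_ideal[OF c I])
  have A: "ideal ?A R" by (rule add_ideals[OF cI M])
  have MA: "?M \<subseteq> ?A" by (rule ideal_sum_right[OF cI M])
  have lenA: "len ?M ?A \<le> 1"
    using "0.prems"(4) unfolding ideal_power_1[OF I] by (simp add: one_enat_def)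
  have B: "ideal ((c \<otimes> y) \<star> carrier R <+> ?M) R" "?M \<subseteq> (c \<otimes> y) \<star> carrier R <+> ?M"
    "(c \<otimes> y) \<star> carrier R <+> ?M \<subseteq> ?A" "c \<otimes> y \<in> (c \<otimes> y) \<star> carrier R <+> ?M" if y: "y \<in> I" for y
  proof -
    have yc: "y \<in> carrier R" using ideal.Icarr[OF I y] .
    have cy: "ideal ((c \<otimes> y) \<star> carrier R) R" using ideal_mult_ideal[OF _ oneideal] c yc by simp
    show "ideal ((c \<otimes> y) \<star> carrier R <+> ?M) R" by (rule add_ideals[OF cy M])
    show "?M \<subseteq> (c \<otimes> y) \<star> carrier R <+> ?M" by (rule ideal_sum_right[OF cy M])
    have "(c \<otimes> y) \<star> carrier R \<subseteq> c \<star> I"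
    proof
      fix x assume "x \<in> (c \<otimes> y) \<star> carrier R"
      then obtain r where r: "r \<in> carrier R" "x = c \<otimes> y \<otimes> r" unfolding mult_ideal_def by blast
      then have "x = c \<otimes> (y \<otimes> r)" using c yc by (simp add: m_assoc)
      then show "x \<in> c \<star> I" using ideal.I_r_closed[OF I y r(1)] unfolding mult_ideal_def by blast
    qed
    then show "(c \<otimes> y) \<star> carrier R <+> ?M \<subseteq> ?A" by (rule set_add_mono)
    have "c \<otimes> y = c \<otimes> y \<otimes> \<one>" using c yc by simp
    then have "c \<otimes> y \<in> (c \<otimes> y) \<star> carrier R" unfolding mult_ideal_def by blast
    then show "c \<otimes> y \<in> (c \<otimes> y) \<star> carrier R <+> ?M" using ideal_sum_left[OF cy M] by blast
  qed
  let ?V = "{z \<in> I. c \<otimes> z \<in> ?M}"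
  have V: "ideal ?V R"
  proof (rule ideal_cringI)
    show "?V \<subseteq> carrier R" using ideal_subset[OF I] by blast
    show "\<zero> \<in> ?V" using ideal_zero[OF I] ideal_zero[OF M] c by simp
    show "x \<oplus> y \<in> ?V" if xy: "x \<in> ?V" "y \<in> ?V" for x y
    proof -
      have "x \<in> carrier R" "y \<in> carrier R" using xy ideal.Icarr[OF I] by auto
      then show ?thesis using xy c ideal_add[OF I] ideal_add[OF M] by (simp add: r_distr)
    qed
    show "r \<otimes> x \<in> ?V" if rx: "r \<in> carrier R" "x \<in> ?V" for r x
    proof -
      have "x \<in> carrier R" using rx ideal.Icarr[OF I] by auto
      then show ?thesis
        using rx c ideal.I_l_closed[OF I] ideal.I_l_closed[OF M] by (simp add: m_lcomm[of c r x])
    qed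
  qed
  \<comment> \<open>If \<open>c\<close> sends \<open>I\<close> into \<open>?M\<close>, both sides
    equal \<open>?M\<close> and any generic \<open>y\<close> serves. Otherwise a generic
    \<open>y\<close> outside \<open>?V\<close> makes the left side strictly larger than
    \<open>?M\<close>, and length at most 1 forces equality.\<close>
  have "\<exists>y\<in>I. y \<notin> \<Union>\<V> \<and> (c \<otimes> y) \<star> carrier R <+> ?M = ?A"
  proof (cases "I \<subseteq> ?V")
    case True
    obtain y where y: "y \<in> I" "y \<notin> \<Union>\<V>"
      using ideal_avoidance[OF inf I "0.prems"(2,3)] by blast
    have "c \<star> I \<subseteq> ?M" using True unfolding mult_ideal_def[of c] by blast
    then have "?A \<subseteq> ?M" by (intro ideal_sum_least[OF M]) auto
    then have "?A \<subseteq> (c \<otimes> y) \<star> carrier R <+> ?M" using B(2)[OF y(1)] by (rule order.trans)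
    then show ?thesis using y B(3)[OF y(1)] by blast
  next
    case False
    have "\<exists>y\<in>I. y \<notin> \<Union>(insert ?V \<V>)"
      by (rule ideal_avoidance[OF inf I]) (use "0.prems"(2,3) V False in auto)
    then obtain y where y: "y \<in> I" "y \<notin> \<Union>\<V>" "y \<notin> ?V" by blast
    let ?B = "(c \<otimes> y) \<star> carrier R <+> ?M"
    have "c \<otimes> y \<notin> ?M" using y by blast
    then have "?M \<noteq> ?B" using B(4)[OF y(1)] by blast
    then have nz: "len ?M ?B \<noteq> 0" using len_eq_0_iff[OF M B(1,2)[OF y(1)]] by simp
    have "len ?M ?B \<le> 1"
      using len_mono[OF order.refl B(3)[OF y(1)]] lenA by (rule order.trans)
    then have fin: "len ?M ?B \<noteq> \<infinity>" by (cases "len ?M ?B") (auto simp: one_enat_def)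
    have "1 \<le> len ?M ?B"
      using nz by (cases "len ?M ?B") (auto simp: one_enat_def zero_enat_def)
    with lenA have "len ?M ?A \<le> len ?M ?B" by (rule order.trans)
    then have "?B = ?A"
      by (rule len_finite_eq[OF M B(1)[OF y(1)] A B(2)[OF y(1)] B(3)[OF y(1)] _ fin])
    then show ?thesis using y by blast
  qed
  then show ?case using ideal_power_1[OF I] by simp
next
  case (Suc n)
  let ?P = "ideal_power R I"
  let ?M = "a \<star> ?P (k + Suc (Suc n))"
  let ?A = "c \<star> ?P (Suc (Suc n)) <+> ?M"
  let ?B = "\<lambda>y. (c \<otimes> y) \<star> ?P (Suc n) <+> ?M"
  have P: "ideal (?P j) R" for j by (rule ideal_ideal_power[OF I])
  have c: "c \<in> carrier R" using ideal.Icarr[OF P Suc.prems(1)] .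
  have Icar: "y \<in> carrier R" if "y \<in> I" for y using ideal.Icarr[OF I that] .
  have M: "ideal ?M R" by (rule ideal_mult_ideal[OF a P])
  have cP: "ideal (c \<star> ?P (Suc (Suc n))) R" by (rule ideal_mult_ideal[OF c P])
  have A: "ideal ?A R" by (rule add_ideals[OF cP M])
  have MA: "?M \<subseteq> ?A" by (rule ideal_sum_right[OF cP M])
  have mulP: "y \<otimes> w \<in> ?P (Suc j)" if "y \<in> I" "w \<in> ?P j" for y w j
    using mult_mem_ideal_power[OF I, of y 1 w j] that by (simp add: ideal_power_1[OF I])
  have cy: "ideal ((c \<otimes> y) \<star> ?P (Suc n)) R" if "y \<in> I" for y
    using ideal_mult_ideal[OF _ P] c Icar[OF that] by simp
  have B: "ideal (?B y) R" "?M \<subseteq> ?B y" if y: "y \<in> I" for y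
    by (rule add_ideals[OF cy[OF y] M], rule ideal_sum_right[OF cy[OF y] M])
  have BA: "?B y \<subseteq> ?A" if y: "y \<in> I" for y
  proof (rule set_add_mono, rule subsetI)
    fix x assume "x \<in> (c \<otimes> y) \<star> ?P (Suc n)"
    then obtain w where w: "w \<in> ?P (Suc n)" "x = c \<otimes> y \<otimes> w" unfolding mult_ideal_def by blast
    then have "x = c \<otimes> (y \<otimes> w)" using c Icar[OF y] ideal.Icarr[OF P w(1)] by (simp add: m_assoc)
    then show "x \<in> c \<star> ?P (Suc (Suc n))" using mulP[OF y w(1)] unfolding mult_ideal_def by blast
  qed
  have lenB: "len ?M (?B y) \<le> enat (Suc (Suc n))" if y: "y \<in> I" for y
    using len_mono[OF order.refl BA[OF y]] Suc.prems(4) by (rule order.trans)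
  have finB: "len ?M (?B y) = enat (the_enat (len ?M (?B y)))" if y: "y \<in> I" for y
    using lenB[OF y] by (cases "len ?M (?B y)") auto
  obtain y0 where y0: "y0 \<in> I \<and> y0 \<notin> \<Union>\<V>"
    using ideal_avoidance[OF inf I Suc.prems(2,3)] by blast
  have bound: "\<forall>y. y \<in> I \<and> y \<notin> \<Union>\<V> \<longrightarrow> the_enat (len ?M (?B y)) < Suc (Suc (Suc n))"
  proof (intro allI impI)
    fix y assume "y \<in> I \<and> y \<notin> \<Union>\<V>"
    then have "y \<in> I" by blast
    from lenB[OF this] show "the_enat (len ?M (?B y)) < Suc (Suc (Suc n))"
      by (subst (asm) finB[OF \<open>y \<in> I\<close>]) simp
  qed
  obtain y where y: "y \<in> I" "y \<notin> \<Union>\<V>"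
    and max: "\<And>z. z \<in> I \<Longrightarrow> z \<notin> \<Union>\<V> \<Longrightarrow> the_enat (len ?M (?B z)) \<le> the_enat (len ?M (?B y))"
    using ex_has_greatest_nat[of "\<lambda>y. y \<in> I \<and> y \<notin> \<Union>\<V>", OF y0 bound] by blast
  have max': "len ?M (?B z) \<le> len ?M (?B y)" if "z \<in> I" "z \<notin> \<Union>\<V>" for z
    using max[OF that] by (subst finB[OF that(1)], subst finB[OF y(1)]) simp
  show ?case
  proof (cases "?B y = ?A")
    case True
    then show ?thesis using y by blast
  next
    case False
    have yc: "y \<in> carrier R" using Icar[OF y(1)] .
    \<comment> \<open>A failing \<open>y\<close> gives a strictly smaller ideal, which lowers the
      length bound to the one required by the induction hypothesis.\<close>
    have "len ?M (?B y) + 1 \<le> len ?M ?A"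
      using False BA[OF y(1)] by (intro len_strict_mono[OF M B(1)[OF y(1)] A B(2)[OF y(1)]]) blast
    then have "len ?M (?B y) + 1 \<le> enat (Suc (Suc n))" using Suc.prems(4) by (rule order.trans)
    then have small: "len ?M (?B y) \<le> enat (Suc n)"
      by (cases "len ?M (?B y)") (auto simp: one_enat_def)
    let ?V = "{z \<in> I. \<forall>w\<in>?P (Suc n). c \<otimes> z \<otimes> w \<in> ?B y}"
    note By = B(1)[OF y(1)]
    have V: "ideal ?V R"
    proof (rule ideal_cringI)
      show "?V \<subseteq> carrier R" using ideal_subset[OF I] by blast
      show "\<zero> \<in> ?V" using ideal_zero[OF I] ideal_zero[OF By] c ideal.Icarr[OF P] by auto
      show "u \<oplus> v \<in> ?V" if uv: "u \<in> ?V" "v \<in> ?V" for u v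
      proof -
        have uvc: "u \<in> carrier R" "v \<in> carrier R" using uv Icar by auto
        have "c \<otimes> (u \<oplus> v) \<otimes> w \<in> ?B y" if w: "w \<in> ?P (Suc n)" for w
        proof -
          have "c \<otimes> u \<otimes> w \<oplus> c \<otimes> v \<otimes> w \<in> ?B y" using uv w ideal_add[OF By] by blast
          then show ?thesis using uvc c ideal.Icarr[OF P w] by (simp add: r_distr l_distr)
        qed
        then show ?thesis using uv ideal_add[OF I] by blast
      qed
      show "r \<otimes> u \<in> ?V" if ru: "r \<in> carrier R" "u \<in> ?V" for r u
      proof -
        have uc: "u \<in> carrier R" using ru Icar by auto
        have "c \<otimes> (r \<otimes> u) \<otimes> w \<in> ?B y" if w: "w \<in> ?P (Suc n)" for w
        proof -
          have "r \<otimes> (c \<otimes> u \<otimes> w) \<in> ?B y" using ru w ideal.I_l_closed[OF By] by blast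
          then show ?thesis using uc c ru(1) ideal.Icarr[OF P w] by (simp add: m_ac)
        qed
        then show ?thesis using ru ideal.I_l_closed[OF I] by blast
      qed
    qed
    \<comment> \<open>If \<open>?V\<close> were all of \<open>I\<close>, then multiplication by
      \<open>c\<close> would send all products \<open>w \<otimes> z\<close> generating
      \<open>I^(n+2)\<close> into \<open>?B y\<close>, and \<open>y\<close> would not have
      failed.\<close>
    have IV: "\<not> I \<subseteq> ?V"
    proof
      assume IV: "I \<subseteq> ?V"
      let ?D = "{w \<in> carrier R. c \<otimes> w \<in> ?B y}"
      have D: "ideal ?D R"
      proof (rule ideal_cringI)
        show "\<zero> \<in> ?D" using ideal_zero[OF By] c by simp
        show "u \<oplus> v \<in> ?D" if "u \<in> ?D" "v \<in> ?D" for u v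
          using that ideal_add[OF By] c by (simp add: r_distr)
        show "r \<otimes> u \<in> ?D" if "r \<in> carrier R" "u \<in> ?D" for r u
          using that ideal.I_l_closed[OF By] c by (simp add: m_lcomm[of c r u])
      qed blast
      have "?P (Suc n) \<cdot> I \<subseteq> ?D"
      proof (rule ideal_prod_least[OF D])
        fix w z assume w: "w \<in> ?P (Suc n)" and z: "z \<in> I"
        have "c \<otimes> z \<otimes> w \<in> ?B y" using IV w z by blast
        moreover have "c \<otimes> z \<otimes> w = c \<otimes> (w \<otimes> z)"
          using c Icar[OF z] ideal.Icarr[OF P w] by (simp add: m_ac)
        ultimately show "w \<otimes> z \<in> ?D" using Icar[OF z] ideal.Icarr[OF P w] by simp
      qed
      then have "c \<star> ?P (Suc (Suc n)) \<subseteq> ?B y"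
        unfolding ideal_power_Suc[of I "Suc n"] mult_ideal_def[of c] by blast
      then have "?A \<subseteq> ?B y" by (rule ideal_sum_least[OF By _ B(2)[OF y(1)]])
      then show False using False BA[OF y(1)] by blast
    qed
    have cyP: "c \<otimes> y \<in> ?P (Suc k)"
      using mult_mem_ideal_power[OF I Suc.prems(1), of y 1] y(1) by (simp add: ideal_power_1[OF I])
    \<comment> \<open>Passing from \<open>c\<close> to \<open>c \<otimes> y\<close> raises the
      degree by one while \<open>n\<close> drops by one, so the induction hypothesis speaks of the
      same \<open>?M\<close>.\<close>
    have idx: "Suc k + Suc n = k + Suc (Suc n)" by simp
    have "\<exists>z\<in>I. z \<notin> \<Union>(insert ?V \<V>) \<and> (c \<otimes> y \<otimes> z) \<star> ?P n <+> ?M = ?B y"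
      using Suc.IH[of "c \<otimes> y" "Suc k" "insert ?V \<V>", unfolded idx, OF cyP _ _ small]
        Suc.prems(2,3) V IV by blast
    then obtain z where z: "z \<in> I" "z \<notin> \<Union>\<V>" "z \<notin> ?V"
      and eq: "(c \<otimes> y \<otimes> z) \<star> ?P n <+> ?M = ?B y" by blast
    have "(c \<otimes> y \<otimes> z) \<star> ?P n \<subseteq> (c \<otimes> z) \<star> ?P (Suc n)"
    proof
      fix x assume "x \<in> (c \<otimes> y \<otimes> z) \<star> ?P n"
      then obtain w where w: "w \<in> ?P n" "x = c \<otimes> y \<otimes> z \<otimes> w" unfolding mult_ideal_def by blast
      then have "x = (c \<otimes> z) \<otimes> (y \<otimes> w)"
        using c yc Icar[OF z(1)] ideal.Icarr[OF P w(1)] by (simp add: m_ac)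
      then show "x \<in> (c \<otimes> z) \<star> ?P (Suc n)" using mulP[OF y(1) w(1)] unfolding mult_ideal_def by blast
    qed
    then have "?B y \<subseteq> ?B z" unfolding eq[symmetric] by (rule set_add_mono)
    moreover have "len ?M (?B y) \<noteq> \<infinity>" by (subst finB[OF y(1)]) simp
    ultimately have "?B y = ?B z"
      by (intro len_finite_eq[OF M By B(1)[OF z(1)] B(2)[OF y(1)] _ max'[OF z(1,2)]])
    then have "(c \<otimes> z) \<star> ?P (Suc n) \<subseteq> ?B y" using ideal_sum_left[OF cy[OF z(1)] M] by simp
    then have "z \<in> ?V" using z(1) unfolding mult_ideal_def[of "c \<otimes> z"] by blast
    then show ?thesis using z(3) by blast
  qed
qed

end

section \<open>Ideals containing a nonzerodivisor and the Eakin-Sathaye theorem for them\<close>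

context one_dimensional_local_ring
begin

text \<open>This class contains \<open>R\<close> and is closed under products, so it covers all
  powers of an ideal including the zeroth; its members have finite colength.\<close>

definition reg_ideal :: "'a set \<Rightarrow> bool" where
  "reg_ideal J \<longleftrightarrow> ideal J R \<and> (\<exists>a\<in>J. regular a)"

lemma reg_ideal_ideal: "reg_ideal J \<Longrightarrow> ideal J R"
  by (simp add: reg_ideal_def)

lemma reg_ideal_carrier: "reg_ideal (carrier R)"
proof -
  have "regular \<one>" by (rule regularI) auto
  then show ?thesis unfolding reg_ideal_def using oneideal one_closed by blast
qed

lemma reg_ideal_prod: "reg_ideal J \<Longrightarrow> reg_ideal K \<Longrightarrow> reg_ideal (J \<cdot> K)"
  unfolding reg_ideal_def using ideal_prod_is_ideal ideal_prod.prod regular_mult by metis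

lemma reg_ideal_power: "reg_ideal J \<Longrightarrow> reg_ideal (ideal_power R J n)"
  by (induction n) (auto simp: ideal_power_Suc reg_ideal_carrier reg_ideal_prod)

lemma reg_ideal_finite_colength: "reg_ideal J \<Longrightarrow> len J (carrier R) \<noteq> \<infinity>"
  unfolding reg_ideal_def using finite_colength by blast

lemma len_mult_reg_ideal:
  "regular y \<Longrightarrow> reg_ideal J \<Longrightarrow> len (y \<star> J) J = len (y \<star> carrier R) (carrier R)"
  by (intro len_quot_mult_ideal reg_ideal_finite_colength reg_ideal_ideal)

lemma mult_ideal_power_le:
  assumes "ideal I R" "y \<in> I"
  shows "y \<star> ideal_power R I n \<subseteq> ideal_power R I (Suc n)"
proof
  fix x assume "x \<in> y \<star> ideal_power R I n"
  then obtain w where "w \<in> ideal_power R I n" "x = y \<otimes> w" unfolding mult_ideal_def by blast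
  then show "x \<in> ideal_power R I (Suc n)"
    using mult_mem_ideal_power[OF assms(1), of y 1 w n] assms(2) by (simp add: ideal_power_1[OF assms(1)])
qed

text \<open>The graded statement with \<open>k = 0\<close>, \<open>c = 1\<close> and no ideals to
  avoid; its length hypothesis holds because \<open>I^(n+1)/aI^(n+1)\<close> has the length of
  \<open>R/a\<close>. It gives \<open>I^(n+1) = yI^n + aI^(n+1)\<close>, and Nakayama removes the
  last summand.\<close>

lemma eakin_sathaye:
  assumes inf: "infinite (carrier (R Quot m))" and I: "reg_ideal I"
    and a: "regular a" "a \<in> m" and le: "len (a \<star> carrier R) (carrier R) \<le> enat (Suc n)"
  shows "\<exists>y\<in>I. y \<star> ideal_power R I n = ideal_power R I (Suc n)"
proof -
  let ?P = "ideal_power R I"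
  have idI: "ideal I R" and P: "ideal (?P j) R" for j
    using I reg_ideal_ideal ideal_ideal_power by blast+
  have ac: "a \<in> carrier R" using a by simp
  have aP: "ideal (a \<star> ?P (Suc n)) R" by (rule ideal_mult_ideal[OF ac P])
  have one: "\<one> \<star> ?P (Suc n) = ?P (Suc n)"
    unfolding mult_ideal_def using ideal.Icarr[OF P] by (auto simp: image_iff)
  have sum: "\<one> \<star> ?P (Suc n) <+> a \<star> ?P (Suc n) = ?P (Suc n)"
    unfolding one
    using ideal_sum_left[OF P aP] ideal_sum_least[OF P order.refl mult_ideal_le[OF ac P]] by blast
  have "len (a \<star> ?P (Suc n)) (?P (Suc n)) \<le> enat (Suc n)"
    using len_mult_reg_ideal[OF a(1) reg_ideal_power[OF I]] le by simp
  then have "\<exists>y\<in>I. y \<notin> \<Union>{} \<and> (\<one> \<otimes> y) \<star> ?P n <+> a \<star> ?P (0 + Suc n) =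
      \<one> \<star> ?P (Suc n) <+> a \<star> ?P (0 + Suc n)"
    by (intro eakin_sathaye_aux[OF inf idI ac]) (auto simp: sum)
  then obtain y where y: "y \<in> I" and eq: "(\<one> \<otimes> y) \<star> ?P n <+> a \<star> ?P (Suc n) = ?P (Suc n)"
    by (auto simp: sum)
  have yc: "y \<in> carrier R" using ideal.Icarr[OF idI y] .
  have "y \<star> ?P n = ?P (Suc n)"
  proof (rule nakayama[OF _ P _ a(2)])
    show "ideal (y \<star> ?P n) R" by (rule ideal_mult_ideal[OF yc P])
    show "y \<star> ?P n \<subseteq> ?P (Suc n)" by (rule mult_ideal_power_le[OF idI y])
    show "?P (Suc n) \<subseteq> y \<star> ?P n <+> a \<star> ?P (Suc n)" using eq yc by simp
  qed
  then show ?thesis using y by blast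
qed

end


section \<open>Reductions and Hilbert functions\<close>

lemma enat_the_enat_eq: "n \<noteq> \<infinity> \<Longrightarrow> enat (the_enat n) = n"
  by (cases n) auto

text \<open>The Cohen-Macaulay property enters as a nonzerodivisor in \<open>m\<close>, which
  \<open>ex_regular_in_m\<close> extracts from the depth.\<close>

locale one_dimensional_cm_ring = one_dimensional_local_ring +
  assumes infinite_residue_field: "infinite (carrier (R Quot m))"
    and ex_regular: "\<exists>a\<in>m. regular a"
begin

section \<open>Principal reductions and the Hilbert function\<close>

definition principal_reduction :: "'a set \<Rightarrow> 'a \<Rightarrow> bool" where
  "principal_reduction I y \<longleftrightarrow>
    y \<in> I \<and> (\<exists>n. y \<star> ideal_power R I n = ideal_power R I (Suc n))"

definition principal_colength :: "'a \<Rightarrow> nat" where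
  "principal_colength y = the_enat (len (y \<star> carrier R) (carrier R))"

lemma reg_ideal_principal: "regular y \<Longrightarrow> reg_ideal (y \<star> carrier R)"
proof -
  assume y: "regular y"
  then have "y = y \<otimes> \<one>" by simp
  then have "y \<in> y \<star> carrier R" unfolding mult_ideal_def by blast
  then show ?thesis unfolding reg_ideal_def
    using y ideal_mult_ideal[OF regular_carrier[OF y] oneideal] by blast
qed

lemma len_principal:
  assumes "regular y"
  shows "len (y \<star> carrier R) (carrier R) = enat (principal_colength y)"
  using reg_ideal_finite_colength[OF reg_ideal_principal[OF assms]]
  unfolding principal_colength_def by (simp add: enat_the_enat_eq)

text \<open>Eakin-Sathaye with \<open>n + 1\<close> the length of \<open>R/a\<close>. The exponent
  does not depend on \<open>I\<close>, which is the source of the uniform bound on postulation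
  numbers.\<close>

lemma ex_power_eq:
  assumes I: "reg_ideal I" and a: "regular a" "a \<in> m"
  shows "\<exists>y\<in>I. y \<star> ideal_power R I (principal_colength a - 1) =
    ideal_power R I (Suc (principal_colength a - 1))"
  by (rule eakin_sathaye[OF infinite_residue_field I a]) (simp add: len_principal[OF a(1)])

lemma ex_principal_reduction: "reg_ideal I \<Longrightarrow> \<exists>y. principal_reduction I y"
  using ex_regular ex_power_eq unfolding principal_reduction_def by blast

text \<open>Some power \<open>I^(n+1) = yI^n\<close> contains a nonzerodivisor, of which
  \<open>y\<close> is a factor.\<close>

lemma principal_reduction_regular:
  assumes I: "reg_ideal I" and y: "principal_reduction I y"
  shows "regular y"
proof -
  obtain n where n: "y \<in> I" "y \<star> ideal_power R I n = ideal_power R I (Suc n)"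
    using y unfolding principal_reduction_def by blast
  have "reg_ideal (ideal_power R I (Suc n))" by (rule reg_ideal_power[OF I])
  then obtain b where b: "b \<in> ideal_power R I (Suc n)" "regular b" unfolding reg_ideal_def by blast
  then obtain w where w: "w \<in> ideal_power R I n" "b = y \<otimes> w"
    unfolding n(2)[symmetric] mult_ideal_def by blast
  have "y \<in> carrier R" "w \<in> carrier R"
    using ideal.Icarr[OF reg_ideal_ideal[OF I] n(1)]
      ideal.Icarr[OF reg_ideal_ideal[OF reg_ideal_power[OF I]] w(1)] by auto
  then show ?thesis by (rule regular_factor) (use b w in simp)
qed

text \<open>Additivity along \<open>yI^n\<close>, \<open>I^(n+1)\<close>, \<open>I^n\<close>, where
  \<open>I^n/yI^n\<close> has the length of \<open>R/y\<close> for every \<open>n\<close>. The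
  second summand is the defect of the Hilbert function at \<open>n\<close>.\<close>

lemma hilb0_add_len:
  assumes I: "reg_ideal I" and y: "regular y" "y \<in> I"
  shows "enat (hilb0 R I n) + len (y \<star> ideal_power R I n) (ideal_power R I (Suc n)) =
    enat (principal_colength y)"
proof -
  let ?P = "ideal_power R I"
  have idI: "ideal I R" by (rule reg_ideal_ideal[OF I])
  have P: "ideal (?P j) R" for j by (rule ideal_ideal_power[OF idI])
  have sub: "?P (Suc n) \<subseteq> ?P n" by (rule ideal_power_antimono[OF idI]) simp
  have yP: "ideal (y \<star> ?P n) R" by (rule ideal_mult_ideal[OF regular_carrier[OF y(1)] P])
  have "len (?P (Suc n)) (?P n) \<le> len (?P (Suc n)) (carrier R)"
    by (rule len_mono[OF order.refl ideal_subset[OF P]])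
  then have "len (?P (Suc n)) (?P n) \<noteq> \<infinity>"
    using reg_ideal_finite_colength[OF reg_ideal_power[OF I]] by (metis enat_ord_simps(5))
  then have "enat (hilb0 R I n) = len (?P (Suc n)) (?P n)"
    unfolding hilb0_def using quot_length_eq[OF P P sub] by (simp add: enat_the_enat_eq)
  moreover have "len (y \<star> ?P n) (?P n) =
      len (y \<star> ?P n) (?P (Suc n)) + len (?P (Suc n)) (?P n)"
    by (rule len_add[OF yP mult_ideal_power_le[OF idI y(2)] P sub P])
  moreover have "len (y \<star> ?P n) (?P n) = enat (principal_colength y)"
    using len_mult_reg_ideal[OF y(1) reg_ideal_power[OF I]] len_principal[OF y(1)] by simp
  ultimately show ?thesis by (simp add: add.commute)
qed

lemma hilb0_le:
  assumes "reg_ideal I" "regular y" "y \<in> I"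
  shows "hilb0 R I n \<le> principal_colength y"
  using hilb0_add_len[OF assms, of n]
  by (cases "len (y \<star> ideal_power R I n) (ideal_power R I (Suc n))") auto

lemma hilb0_eq_iff:
  assumes I: "reg_ideal I" and y: "regular y" "y \<in> I"
  shows "hilb0 R I n = principal_colength y \<longleftrightarrow>
    y \<star> ideal_power R I n = ideal_power R I (Suc n)"
proof -
  let ?P = "ideal_power R I"
  have idI: "ideal I R" by (rule reg_ideal_ideal[OF I])
  have P: "ideal (?P j) R" for j by (rule ideal_ideal_power[OF idI])
  have yP: "ideal (y \<star> ?P n) R" by (rule ideal_mult_ideal[OF regular_carrier[OF y(1)] P])
  have "hilb0 R I n = principal_colength y \<longleftrightarrow> len (y \<star> ?P n) (?P (Suc n)) = 0"
    using hilb0_add_len[OF assms, of n]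
    by (cases "len (y \<star> ideal_power R I n) (ideal_power R I (Suc n))") (auto simp: zero_enat_def)
  also have "\<dots> \<longleftrightarrow> y \<star> ?P n = ?P (Suc n)"
    by (rule len_eq_0_iff[OF yP P mult_ideal_power_le[OF idI y(2)]])
  finally show ?thesis .
qed

text \<open>Multiply the equation by \<open>I\<close> repeatedly.\<close>

lemma power_eq_persists:
  assumes I: "ideal I R" and y: "y \<in> carrier R"
    and eq: "y \<star> ideal_power R I n = ideal_power R I (Suc n)" and "n \<le> k"
  shows "y \<star> ideal_power R I k = ideal_power R I (Suc k)"
  using assms(4)
proof (induction k rule: dec_induct)
  case (step k)
  have "ideal_power R I (Suc (Suc k)) = (y \<star> ideal_power R I k) \<cdot> I"
    using step.IH by (simp add: ideal_power_Suc[of I "Suc k"])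
  then show ?case
    using mult_ideal_prod[OF y ideal_ideal_power[OF I] I, of k] by (simp add: ideal_power_Suc[of I k])
qed (rule eq)

lemma hilb0_eventually:
  assumes I: "reg_ideal I" and y: "principal_reduction I y"
  shows "\<exists>n. \<forall>k\<ge>n. hilb0 R I k = principal_colength y"
proof -
  have yr: "regular y" "y \<in> I"
    using principal_reduction_regular[OF assms] y by (auto simp: principal_reduction_def)
  obtain n where n: "y \<star> ideal_power R I n = ideal_power R I (Suc n)"
    using y unfolding principal_reduction_def by blast
  have "hilb0 R I k = principal_colength y" if "n \<le> k" for k
    unfolding hilb0_eq_iff[OF I yr]
    by (rule power_eq_persists[OF reg_ideal_ideal[OF I] regular_carrier[OF yr(1)] n that])
  then show ?thesis by blast
qed

lemma e0_eq:
  assumes I: "reg_ideal I" and y: "principal_reduction I y"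
  shows "e0 R I = int (principal_colength y)"
  unfolding e0_def
proof (rule the_equality)
  have ev: "\<forall>\<^sub>F n in sequentially. int (hilb0 R I n) = int (principal_colength y)"
    using hilb0_eventually[OF assms] by (simp add: eventually_sequentially)
  then show "\<forall>\<^sub>F n in sequentially. int (hilb0 R I n) = int (principal_colength y)" .
  fix e :: int assume "\<forall>\<^sub>F n in sequentially. int (hilb0 R I n) = e"
  with ev have "\<forall>\<^sub>F n in sequentially. e = int (principal_colength y)"
    by eventually_elim simp
  then show "e = int (principal_colength y)" by simp
qed

lemma hilb0_le_e0:
  assumes I: "reg_ideal I"
  shows "int (hilb0 R I n) \<le> e0 R I"
proof -
  obtain y where y: "principal_reduction I y" using ex_principal_reduction[OF I] by blast
  have "regular y" "y \<in> I"
    using principal_reduction_regular[OF I y] y by (auto simp: principal_reduction_def)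
  then show ?thesis using hilb0_le[OF I, of y n] e0_eq[OF I y] by simp
qed

lemma hilb0_eq_e0_iff:
  assumes I: "reg_ideal I" and y: "principal_reduction I y"
  shows "int (hilb0 R I n) = e0 R I \<longleftrightarrow> y \<star> ideal_power R I n = ideal_power R I (Suc n)"
proof -
  have "regular y" "y \<in> I"
    using principal_reduction_regular[OF I y] y by (auto simp: principal_reduction_def)
  then show ?thesis using hilb0_eq_iff[OF I, of y n] e0_eq[OF I y] by simp
qed

lemma hilb0_eq_e0_mono:
  assumes I: "reg_ideal I" and "int (hilb0 R I n) = e0 R I" "n \<le> k"
  shows "int (hilb0 R I k) = e0 R I"
proof -
  obtain y where y: "principal_reduction I y" using ex_principal_reduction[OF I] by blast
  have "y \<in> carrier R" using principal_reduction_regular[OF I y] by simp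
  then show ?thesis
    using assms(2,3) power_eq_persists[OF reg_ideal_ideal[OF I], of y n k]
    unfolding hilb0_eq_e0_iff[OF I y] by blast
qed

text \<open>Equality with \<open>e0 R I\<close> persists, so the condition on all
  \<open>n \<ge> p\<close> reduces to the one at \<open>p\<close>.\<close>

lemma postulation_number_eq:
  assumes I: "reg_ideal I"
  shows "postulation_number R I = (LEAST p. int (hilb0 R I p) = e0 R I)"
proof -
  have "(\<forall>n\<ge>p. int (hilb0 R I n) = e0 R I) \<longleftrightarrow> int (hilb0 R I p) = e0 R I" for p
    using hilb0_eq_e0_mono[OF I, of p] by blast
  then show ?thesis unfolding postulation_number_def by simp
qed

lemma ex_hilb0_eq_e0: "reg_ideal I \<Longrightarrow> \<exists>p. int (hilb0 R I p) = e0 R I"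
  using ex_principal_reduction[of I] hilb0_eq_e0_iff unfolding principal_reduction_def by metis

lemma hilb0_postulation_number:
  assumes "reg_ideal I"
  shows "int (hilb0 R I (postulation_number R I)) = e0 R I"
  unfolding postulation_number_eq[OF assms] by (rule LeastI_ex[OF ex_hilb0_eq_e0[OF assms]])

lemma postulation_number_le:
  "reg_ideal I \<Longrightarrow> int (hilb0 R I p) = e0 R I \<Longrightarrow> postulation_number R I \<le> p"
  by (simp add: postulation_number_eq Least_le)

section \<open>Minimal reductions are principal\<close>

lemma reduction_power:
  assumes I: "ideal I R" and J: "ideal J R"
    and eq: "ideal_power R I (Suc r) = J \<cdot> ideal_power R I r"
  shows "ideal_power R I (r + s) = ideal_power R J s \<cdot> ideal_power R I r"
proof (induction s)
  case 0
  then show ?case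
    using ideal_prod_one[OF ideal_ideal_power[OF I]] ideal_prod_commute[OF oneideal ideal_ideal_power[OF I]]
    by simp
next
  case (Suc s)
  note PI = ideal_ideal_power[OF I] and PJ = ideal_ideal_power[OF J]
  \<comment> \<open>The new factor \<open>I\<close> is absorbed into \<open>I^r\<close>, where
    \<open>I^(r+1) = J I^r\<close> trades it for a factor \<open>J\<close>.\<close>
  have "ideal_power R I (r + Suc s) = (ideal_power R J s \<cdot> ideal_power R I r) \<cdot> I"
    using Suc by (simp add: ideal_power_Suc)
  also have "\<dots> = ideal_power R J s \<cdot> ideal_power R I (Suc r)"
    by (simp add: ideal_prod_assoc[OF PJ PI I] ideal_power_Suc)
  also have "\<dots> = ideal_power R J (Suc s) \<cdot> ideal_power R I r"
    unfolding eq by (simp add: ideal_prod_assoc[OF PJ J PI] ideal_power_Suc)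
  finally show ?case .
qed

text \<open>\<open>J\<close> contains \<open>J I^r = I^(r+1)\<close>, which contains a
  nonzerodivisor.\<close>

lemma reduction_reg_ideal:
  assumes I: "reg_ideal I" and J: "is_reduction R I J"
  shows "reg_ideal J"
proof -
  obtain r where r: "ideal J R" "ideal_power R I (Suc r) = J \<cdot> ideal_power R I r"
    using J unfolding is_reduction_def by auto
  have "J \<cdot> ideal_power R I r \<subseteq> J"
    using ideal_prod_inter[OF r(1) ideal_ideal_power[OF reg_ideal_ideal[OF I]]] by blast
  then show ?thesis
    using reg_ideal_power[OF I, of "Suc r"] r unfolding reg_ideal_def by auto
qed

text \<open>\<open>I^(r+n+1) = J^(n+1) I^r = y J^n I^r = y I^(r+n)\<close>.\<close>

lemma principal_reduction_trans:
  assumes I: "reg_ideal I" and J: "is_reduction R I J" and y: "principal_reduction J y"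
  shows "principal_reduction I y"
proof -
  have idI: "ideal I R" by (rule reg_ideal_ideal[OF I])
  obtain r where r: "ideal J R" "J \<subseteq> I" "ideal_power R I (Suc r) = J \<cdot> ideal_power R I r"
    using J unfolding is_reduction_def by auto
  obtain n where n: "y \<in> J" "y \<star> ideal_power R J n = ideal_power R J (Suc n)"
    using y unfolding principal_reduction_def by blast
  have yc: "y \<in> carrier R" using ideal.Icarr[OF r(1) n(1)] .
  have "ideal_power R I (Suc (r + n)) = ideal_power R J (Suc n) \<cdot> ideal_power R I r"
    using reduction_power[OF idI r(1,3), of "Suc n"] by simp
  also have "\<dots> = y \<star> (ideal_power R J n \<cdot> ideal_power R I r)"
    unfolding n(2)[symmetric]
    by (rule mult_ideal_prod[OF yc ideal_ideal_power[OF r(1)] ideal_ideal_power[OF idI]])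
  also have "\<dots> = y \<star> ideal_power R I (r + n)"
    using reduction_power[OF idI r(1,3), of n] by simp
  finally show ?thesis unfolding principal_reduction_def using n(1) r(2) by blast
qed

lemma is_reduction_principal:
  assumes I: "reg_ideal I" and y: "principal_reduction I y"
  shows "is_reduction R I (y \<star> carrier R)"
proof -
  have idI: "ideal I R" by (rule reg_ideal_ideal[OF I])
  obtain n where n: "y \<in> I" "y \<star> ideal_power R I n = ideal_power R I (Suc n)"
    using y unfolding principal_reduction_def by blast
  have yc: "y \<in> carrier R" using ideal.Icarr[OF idI n(1)] .
  have "y \<star> carrier R \<subseteq> I"
    using mult_ideal_power_le[OF idI n(1), of 0] by (simp add: ideal_power_1[OF idI])
  moreover have "(y \<star> carrier R) \<cdot> ideal_power R I n = ideal_power R I (n + 1)"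
    using cgenideal_prod_eq[OF yc ideal_ideal_power[OF idI]] cgenideal_eq_mult[OF yc] n(2) by simp
  ultimately show ?thesis
    unfolding is_reduction_def using ideal_mult_ideal[OF yc oneideal] by metis
qed

text \<open>Every reduction \<open>J\<close> has a principal reduction, which by transitivity is one
  of \<open>I\<close>, so a minimal \<open>J\<close> is principal. Conversely, a reduction inside
  \<open>(y)\<close> contains some \<open>(z)\<close> of the same kind, and \<open>(z) = (y)\<close>
  because both have colength \<open>e0 R I\<close>.\<close>

lemma minimal_reduction_iff:
  assumes I: "reg_ideal I"
  shows "minimal_reduction R I J \<longleftrightarrow> (\<exists>y. principal_reduction I y \<and> J = y \<star> carrier R)"
proof
  assume J: "minimal_reduction R I J"
  then have red: "is_reduction R I J" by (simp add: minimal_reduction_def)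
  have regJ: "reg_ideal J" by (rule reduction_reg_ideal[OF I red])
  obtain y where y: "principal_reduction J y" using ex_principal_reduction[OF regJ] by blast
  have yI: "principal_reduction I y" by (rule principal_reduction_trans[OF I red y])
  have "y \<star> carrier R \<subseteq> J"
    using is_reduction_principal[OF regJ y] by (simp add: is_reduction_def)
  then have "y \<star> carrier R = J"
    using J is_reduction_principal[OF I yI] unfolding minimal_reduction_def by blast
  then show "\<exists>y. principal_reduction I y \<and> J = y \<star> carrier R" using yI by blast
next
  assume "\<exists>y. principal_reduction I y \<and> J = y \<star> carrier R"
  then obtain y where y: "principal_reduction I y" and J: "J = y \<star> carrier R" by blast
  have yreg: "regular y" by (rule principal_reduction_regular[OF I y])
  have "K = J" if K: "is_reduction R I K" "K \<subseteq> J" for K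
  proof -
    have regK: "reg_ideal K" by (rule reduction_reg_ideal[OF I K(1)])
    obtain z where z: "principal_reduction K z" using ex_principal_reduction[OF regK] by blast
    have zI: "principal_reduction I z" by (rule principal_reduction_trans[OF I K(1) z])
    have zreg: "regular z" by (rule principal_reduction_regular[OF I zI])
    have zK: "z \<star> carrier R \<subseteq> K"
      using is_reduction_principal[OF regK z] by (simp add: is_reduction_def)
    have idz: "ideal (z \<star> carrier R) R" and idy: "ideal (y \<star> carrier R) R"
      using ideal_mult_ideal[OF _ oneideal] yreg zreg by auto
    have col: "principal_colength z = principal_colength y"
      using e0_eq[OF I y] e0_eq[OF I zI] by simp
    have zy: "z \<star> carrier R \<subseteq> y \<star> carrier R" using zK K(2) J by blast
    have "len (z \<star> carrier R) (carrier R) =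
        len (z \<star> carrier R) (y \<star> carrier R) + len (y \<star> carrier R) (carrier R)"
      by (rule len_add[OF idz zy idy ideal_subset[OF idy] oneideal])
    then have "len (z \<star> carrier R) (y \<star> carrier R) = 0"
      unfolding len_principal[OF yreg] len_principal[OF zreg] col
      by (cases "len (z \<star> carrier R) (y \<star> carrier R)") (auto simp: zero_enat_def)
    then have "z \<star> carrier R = y \<star> carrier R" using len_eq_0_iff[OF idz idy zy] by simp
    then show "K = J" using zK K(2) J by blast
  qed
  then show "minimal_reduction R I J"
    unfolding minimal_reduction_def using is_reduction_principal[OF I y] J by blast
qed

text \<open>Whether \<open>I^(r+1) = yI^r\<close> holds is detected by the value of the Hilbert
  function at \<open>r\<close>, hence is independent of the minimal reduction \<open>(y)\<close>.
  Both numbers are the least \<open>r\<close> with this property.\<close>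

lemma reduction_number_eq:
  assumes I: "reg_ideal I"
  shows "reduction_number R I = postulation_number R I"
proof -
  have "(\<exists>J. minimal_reduction R I J \<and> ideal_power R I (r + 1) = J \<cdot> ideal_power R I r) \<longleftrightarrow>
      int (hilb0 R I r) = e0 R I" for r
  proof -
    have prod: "(y \<star> carrier R) \<cdot> ideal_power R I r = y \<star> ideal_power R I r"
      if "principal_reduction I y" for y
      using cgenideal_prod_eq[OF _ ideal_ideal_power[OF reg_ideal_ideal[OF I]]]
        cgenideal_eq_mult regular_carrier[OF principal_reduction_regular[OF I that]] by simp
    have "(\<exists>J. minimal_reduction R I J \<and> ideal_power R I (r + 1) = J \<cdot> ideal_power R I r) \<longleftrightarrow>
        (\<exists>y. principal_reduction I y \<and> y \<star> ideal_power R I r = ideal_power R I (Suc r))"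
      unfolding minimal_reduction_iff[OF I] using prod by force
    also have "\<dots> \<longleftrightarrow> int (hilb0 R I r) = e0 R I"
      using hilb0_eq_e0_iff[OF I] ex_principal_reduction[OF I] by blast
    finally show ?thesis .
  qed
  then show ?thesis unfolding reduction_number_def postulation_number_eq[OF I] by simp
qed

section \<open>Upper bounds for the postulation number\<close>

lemma reg_ideal_m: "reg_ideal m"
  unfolding reg_ideal_def using ideal_m ex_regular by blast

lemma postulation_number_bound:
  assumes I: "reg_ideal I"
  shows "int (postulation_number R I) \<le> e0 R m - 1"
proof -
  obtain x where x: "principal_reduction m x" using ex_principal_reduction[OF reg_ideal_m] by blast
  have xreg: "regular x" "x \<in> m"
    using principal_reduction_regular[OF reg_ideal_m x] x by (auto simp: principal_reduction_def)
  have idx: "ideal (x \<star> carrier R) R" using ideal_mult_ideal[OF _ oneideal] xreg by simp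
  have "x \<star> carrier R \<subseteq> m"
    using is_reduction_principal[OF reg_ideal_m x] by (simp add: is_reduction_def)
  then have "x \<star> carrier R \<noteq> carrier R" using one_notin_m by blast
  \<comment> \<open>Since \<open>x\<close> is not a unit, its colength is positive and the natural
    subtraction of 1 below does not truncate.\<close>
  then have pos: "principal_colength x \<noteq> 0"
    using len_principal[OF xreg(1)] len_eq_0_iff[OF idx oneideal ideal_subset[OF idx]]
    by (auto simp: zero_enat_def)
  obtain y where y: "y \<in> I" "y \<star> ideal_power R I (principal_colength x - 1) =
      ideal_power R I (Suc (principal_colength x - 1))"
    using ex_power_eq[OF I xreg] by blast
  then have pr: "principal_reduction I y" unfolding principal_reduction_def by blast
  have "postulation_number R I \<le> principal_colength x - 1"
    using y hilb0_eq_e0_iff[OF I pr] by (intro postulation_number_le[OF I]) simp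
  then show ?thesis using e0_eq[OF reg_ideal_m x] pos by linarith
qed

text \<open>\<open>e0 R I * (n + 1) - hilb1 R I n\<close> is the sum of the defects up to
  \<open>n\<close>, and the defects from the postulation number on vanish.\<close>

lemma e1_eq:
  assumes I: "reg_ideal I"
  shows "e1 R I = (\<Sum>j<postulation_number R I. e0 R I - int (hilb0 R I j))"
proof -
  let ?p = "postulation_number R I" and ?s = "\<Sum>j<postulation_number R I. e0 R I - int (hilb0 R I j)"
  have h: "int (hilb1 R I n) = e0 R I * (int n + 1) - ?s" if n: "?p \<le> n" for n
  proof -
    have "e0 R I * (int n + 1) - int (hilb1 R I n) = (\<Sum>j\<le>n. e0 R I - int (hilb0 R I j))"
      by (simp add: hilb1_def atMost_atLeast0 sum_subtractf algebra_simps)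
    also have "\<dots> = ?s"
    proof (rule sum.mono_neutral_right)
      show "\<forall>j\<in>{..n} - {..<?p}. e0 R I - int (hilb0 R I j) = 0"
        using hilb0_eq_e0_mono[OF I hilb0_postulation_number[OF I]] by auto
    qed (use n in auto)
    finally show ?thesis by simp
  qed
  have ev: "\<forall>\<^sub>F n in sequentially. int (hilb1 R I n) = e0 R I * (int n + 1) - ?s"
    using h by (auto simp: eventually_sequentially)
  show ?thesis unfolding e1_def
  proof (rule the_equality)
    show "\<forall>\<^sub>F n in sequentially. int (hilb1 R I n) = e0 R I * (int n + 1) - ?s" by (rule ev)
    fix e assume "\<forall>\<^sub>F n in sequentially. int (hilb1 R I n) = e0 R I * (int n + 1) - e"
    with ev have "\<forall>\<^sub>F n in sequentially. e = ?s" by eventually_elim simp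
    then show "e = ?s" by simp
  qed
qed

text \<open>In the third case the defects at 0 and 1 are \<open>e0 R I - colength R I\<close> and
  \<open>e0 R I - conormal_length R I\<close>. The remaining ones below the postulation number
  \<open>p\<close> are at least 1 each, so \<open>e1 R I\<close> exceeds the sum of the first two by
  at least \<open>p - 2\<close>.\<close>

lemma postulation_number_le_beta:
  assumes I: "reg_ideal I"
  shows "int (postulation_number R I) \<le> beta R I"
proof -
  let ?p = "postulation_number R I"
  have idI: "ideal I R" by (rule reg_ideal_ideal[OF I])
  have h0: "hilb0 R I 0 = colength R I"
    by (simp add: hilb0_def colength_def ideal_power_1[OF idI])
  have h1: "hilb0 R I 1 = conormal_length R I"
    by (simp add: hilb0_def conormal_length_def ideal_power_1[OF idI] numeral_2_eq_2)
  \<comment> \<open>\<open>hilb0_le_e0\<close> makes these cases exhaustive, so the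
    \<open>undefined\<close> branch of \<open>beta\<close> is never reached.\<close>
  consider "e0 R I = int (hilb0 R I 0)"
    | "e0 R I \<noteq> int (hilb0 R I 0)" "e0 R I = int (hilb0 R I 1)"
    | "e0 R I \<noteq> int (hilb0 R I 0)" "int (hilb0 R I 1) < e0 R I"
    using hilb0_le_e0[OF I, of 1] by fastforce
  then show ?thesis
  proof cases
    case 1
    then show ?thesis using postulation_number_le[OF I, of 0] by (simp add: beta_def h0)
  next
    case 2
    then show ?thesis
      using postulation_number_le[OF I, of 1] by (simp add: beta_def flip: h0 h1)
  next
    case 3
    \<comment> \<open>The defects at 0 and 1 are nonzero, so the sum for \<open>e1 R I\<close> can
      be split at 2.\<close>
    have "?p \<noteq> 0" "?p \<noteq> 1" using 3 hilb0_postulation_number[OF I] by (metis less_irrefl)+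
    then have p: "2 \<le> ?p" by linarith
    have "1 \<le> e0 R I - int (hilb0 R I j)" if "j < ?p" for j
    proof -
      have "int (hilb0 R I j) \<noteq> e0 R I" using postulation_number_le[OF I, of j] that by auto
      then show ?thesis using hilb0_le_e0[OF I, of j] by simp
    qed
    then have "(\<Sum>j=2..<?p. 1) \<le> (\<Sum>j=2..<?p. e0 R I - int (hilb0 R I j))"
      by (intro sum_mono) auto
    moreover have "e1 R I = (\<Sum>j<2. e0 R I - int (hilb0 R I j)) +
        (\<Sum>j=2..<?p. e0 R I - int (hilb0 R I j))"
      unfolding e1_eq[OF I] lessThan_atLeast0 using p by (simp add: sum.atLeastLessThan_concat)
    moreover have "(\<Sum>j<2. e0 R I - int (hilb0 R I j)) =
        2 * e0 R I - int (hilb0 R I 0) - int (hilb0 R I 1)"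
      by (simp add: numeral_2_eq_2)
    moreover have "(\<Sum>j=2..<?p. 1) = int ?p - 2" using p by simp
    moreover have "beta R I =
        e1 R I - 2 * e0 R I + int (hilb0 R I 0) + int (hilb0 R I 1) + 2"
      using 3 by (simp add: beta_def flip: h0 h1)
    ultimately show ?thesis by linarith
  qed
qed

section \<open>From the hypotheses of the theorem to nonzerodivisors\<close>

lemma primary_to_reg_ideal:
  assumes "primary_to R m I"
  shows "reg_ideal I"
proof -
  have I: "ideal I R" and rad: "ideal_radical R I = m"
    using assms by (auto simp: primary_to_def primary_ideal_def)
  obtain a where a: "a \<in> m" "regular a" using ex_regular by blast
  \<comment> \<open>The radical of \<open>I\<close> is \<open>m\<close>, so a power of the
    nonzerodivisor \<open>a\<close> lies in \<open>I\<close>, and it is again a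
    nonzerodivisor.\<close>
  then obtain n :: nat where "a [^] n \<in> I" using rad unfolding ideal_radical_def by blast
  then show ?thesis unfolding reg_ideal_def using I regular_pow[OF a(2)] by blast
qed

end

text \<open>Positive dimension means positive depth, hence a nonempty regular sequence in
  \<open>m\<close>; its first element is regular modulo the ideal generated by the empty set, which
  is zero.\<close>

lemma (in cohen_macaulay_local_ring) ex_regular_in_m:
  assumes "krull_dim R \<noteq> 0"
  shows "\<exists>a\<in>m. regular a"
proof -
  have "\<exists>xs. regular_sequence R xs \<and> set xs \<subseteq> m \<and> length xs \<noteq> 0"
  proof (rule ccontr)
    assume "\<not> ?thesis"
    then have "length xs = 0" if "regular_sequence R xs" "set xs \<subseteq> m" for xs
      using that by blast
    then have "local_depth R m \<le> 0"
      unfolding local_depth_def by (intro Sup_least) (auto simp: zero_enat_def)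
    then show False using assms depth_eq_dim by simp
  qed
  then obtain xs where xs: "regular_sequence R xs" "set xs \<subseteq> m" "length xs \<noteq> 0" by blast
  then obtain a ys where ays: "xs = a # ys" by (cases xs) auto
  have "Idl {} = {\<zero>}"
    using genideal_minimal[OF zeroideal, of "{}"] ideal_zero[OF genideal_ideal[of "{}"]] by auto
  moreover have "\<forall>x\<in>carrier R. xs ! 0 \<otimes> x \<in> Idl (set (take 0 xs)) \<longrightarrow> x \<in> Idl (set (take 0 xs))"
    using xs(1,3) unfolding regular_sequence_def by blast
  ultimately have "\<forall>x\<in>carrier R. a \<otimes> x = \<zero> \<longrightarrow> x = \<zero>" by (simp add: ays)
  moreover have "a \<in> m" using xs(2) by (simp add: ays)
  ultimately show ?thesis using m.Icarr unfolding regular_def by blast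
qed

theorem proposition2p1:
  fixes R :: "('a, 'b) ring_scheme" (structure) and m I :: "'a set"
  assumes "cohen_macaulay_local_ring R m"
    and "krull_dim R = 1"
    and "infinite (carrier (R Quot m))"
    and "primary_to R m I"
  shows "(reduction_number R I = postulation_number R I \<and>
      enat (postulation_number R I) \<le> stability R m \<and>
      ereal_of_enat (stability R m) \<le> ereal (real_of_int (e0 R m - 1))) \<and>
    int (postulation_number R I) \<le> beta R I"
proof -
  interpret cohen_macaulay_local_ring R m by (rule assms(1))
  interpret one_dimensional_cm_ring R m
    by unfold_locales (use assms(2,3) ex_regular_in_m in auto)
  have I: "reg_ideal I" by (rule primary_to_reg_ideal[OF assms(4)])
  \<comment> \<open>The bound for \<open>I\<close> itself shows that the right side is nonnegative,
    so converting it with \<open>nat\<close> loses nothing.\<close>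
  have pos: "0 \<le> e0 R m - 1"
    using postulation_number_bound[OF I] by linarith
  have "stability R m \<le> enat (nat (e0 R m - 1))"
    unfolding stability_def
  proof (rule SUP_least)
    fix J assume "J \<in> {I. primary_to R m I}"
    then have "reg_ideal J" using primary_to_reg_ideal by simp
    then show "enat (postulation_number R J) \<le> enat (nat (e0 R m - 1))"
      using postulation_number_bound by fastforce
  qed
  then have "ereal_of_enat (stability R m) \<le> ereal_of_enat (enat (nat (e0 R m - 1)))"
    by (simp only: ereal_of_enat_le_iff)
  also have "\<dots> = ereal (real_of_int (e0 R m - 1))"
    using pos by simp
  finally have "ereal_of_enat (stability R m) \<le> ereal (real_of_int (e0 R m - 1))" .
  moreover have "enat (postulation_number R I) \<le> stability R m"
    unfolding stability_def by (rule SUP_upper) (use assms(4) in simp)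
  ultimately show ?thesis
    using reduction_number_eq[OF I] postulation_number_le_beta[OF I] by blast
qed

end
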